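(* Let $\mathfrak{A}$ be a complex unital $C^*$-algebra and let $a\in\mathfrak{A}$ be a non-zero positive element. Let $k\ge 1$, let $x_1,\dots,x_k\in\mathfrak{A}_a$, and for each $j$ let $x_j^{\#_a}$ be an $a$-adjoint of $x_j$. Let $\mu\ge 0$ be real and let $(p_1,\dots,p_k)$ be a probability distribution, i.e. $p_j\ge 0$ for all $j$ and $\sum_{j=1}^k p_j=1$. Then \begin{align*} v_a^4\Big(\sum_{j=1}^k p_jx_j\Big)\le{}& \frac{1+2\mu}{16(1+\mu)}\Big(\sum_{j=1}^k p_j\big\|x_j^{\#_a}x_j+x_jx_j^{\#_a}\big\|_a\Big)^2-\frac{1}{16}c_a^2\Big(\sum_{j=1}^k p_j\big(x_j^{\#_a}x_j-x_jx_j^{\#_a}\big)\Big)\\ &+\frac{3+2\mu}{8(1+\mu)}\,v_a\Big(\sum_{j=1}^k p_jx_j^2\Big)\Bigg(\Big(\sum_{j=1}^k p_j\big\|x_j^{\#_a}x_j+x_jx_j^{\#_a}\big\|_a\Big)^2-c_a^2\Big(\sum_{j=1}^k p_j\big(x_j^{\#_a}x_j-x_jx_j^{\#_a}\big)\Big)\Bigg)^{1/2}. \end{align*}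
   Context: A linear functional $\varphi\in\mathfrak{A}^*$ is positive ($\varphi\ge0$) if $\varphi(x^*x)\ge 0$ for all $x\in\mathfrak{A}$. Set $\mathcal{S}_a(\mathfrak{A})=\{\varphi\in\mathfrak{A}^*:\varphi\ge 0,\ \varphi(a)=1\}$. For $x\in\mathfrak{A}$: the $a$-numerical range is $V_a(x)=\{\varphi(ax):\varphi\in\mathcal{S}_a(\mathfrak{A})\}$; the $a$-numerical radius is $v_a(x)=\sup\{|z|:z\in V_a(x)\}$; the $a$-Crawford number is $c_a(x)=\inf\{|z|:z\in V_a(x)\}$; and $\|x\|_a=\sup\{\sqrt{\varphi(x^*ax)}:\varphi\in\mathcal{S}_a(\mathfrak{A})\}$. An element $x^{\#_a}\in\mathfrak{A}$ is called an $a$-adjoint of $x\in\mathfrak{A}$ if $x^*a=ax^{\#_a}$ (it need not exist or be unique); $\mathfrak{A}_a$ is the set of all $x\in\mathfrak{A}$ that have an $a$-adjoint. Powers such as $v_a^4(x)$ and $c_a^2(x)$ mean $(v_a(x))^4$ and $(c_a(x))^2$. *)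

theory Defs
  imports "HOL-Analysis.Analysis"
begin

(* Complex unital C*-algebras.  The superclass real_normed_algebra_1 supplies the unit,
   norm 1 = 1 and submultiplicativity.  Requiring norm 1 = 1 excludes only the zero algebra,
   since in every other unital C*-algebra it follows from the C*-identity. *)
class unital_cstar_algebra = real_normed_algebra_1 + banach +
  fixes scaleC :: "complex \<Rightarrow> 'a \<Rightarrow> 'a" (infixr "*\<^sub>C" 75)
    and star :: "'a \<Rightarrow> 'a"
  assumes scaleC_add_right: "c *\<^sub>C (x + y) = c *\<^sub>C x + c *\<^sub>C y"
    and scaleC_add_left: "(c + d) *\<^sub>C x = c *\<^sub>C x + d *\<^sub>C x"
    and scaleC_scaleC: "c *\<^sub>C d *\<^sub>C x = (c * d) *\<^sub>C x"
    and scaleC_of_real: "complex_of_real r *\<^sub>C x = r *\<^sub>R x"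
    and scaleC_mult_left: "(c *\<^sub>C x) * y = c *\<^sub>C (x * y)"
    and scaleC_mult_right: "x * (c *\<^sub>C y) = c *\<^sub>C (x * y)"
    and norm_scaleC: "norm (c *\<^sub>C x) = cmod c * norm x"
    and star_star: "star (star x) = x"
    and star_add: "star (x + y) = star x + star y"
    and star_scaleC: "star (c *\<^sub>C x) = cnj c *\<^sub>C star x"
    and star_mult: "star (x * y) = star y * star x"
    and cstar_identity: "norm (star x * x) = (norm x)\<^sup>2"

definition spectrum :: "'a::unital_cstar_algebra \<Rightarrow> complex set" where
  "spectrum x = {c. \<not> (\<exists>y. (c *\<^sub>C 1 - x) * y = 1 \<and> y * (c *\<^sub>C 1 - x) = 1)}"

definition positive_element :: "'a::unital_cstar_algebra \<Rightarrow> bool" where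
  "positive_element x \<longleftrightarrow> star x = x \<and> spectrum x \<subseteq> \<real>\<^sub>\<ge>\<^sub>0"

(* The dual space: bounded complex-linear functionals
   (bounded_linear by itself gives only real linearity). *)
definition dual_space :: "('a::unital_cstar_algebra \<Rightarrow> complex) set" where
  "dual_space = {\<phi>. bounded_linear \<phi> \<and> (\<forall>c x. \<phi> (c *\<^sub>C x) = c * \<phi> x)}"

definition positive_functional :: "('a::unital_cstar_algebra \<Rightarrow> complex) \<Rightarrow> bool" where
  "positive_functional \<phi> \<longleftrightarrow> (\<forall>x. \<phi> (star x * x) \<in> \<real>\<^sub>\<ge>\<^sub>0)"

definition a_states :: "'a::unital_cstar_algebra \<Rightarrow> ('a \<Rightarrow> complex) set" where
  "a_states a = {\<phi> \<in> dual_space. positive_functional \<phi> \<and> \<phi> a = 1}"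

definition a_numerical_range :: "'a::unital_cstar_algebra \<Rightarrow> 'a \<Rightarrow> complex set" where
  "a_numerical_range a x = {\<phi> (a * x) |\<phi>. \<phi> \<in> a_states a}"

(* The suprema and infima below are taken in the reals.  For positive a \<noteq> 0 the set a_states a
   is nonempty, and if x has an a-adjoint y, then the Cauchy-Schwarz inequality for \<phi> gives
   \<bar>\<phi> (a * x)\<bar>\<^sup>2 \<le> \<phi> (star x * a * x) = \<phi> (a * (y * x)) \<le> norm (y * x),
   so they are genuine for such x. *)
definition a_numerical_radius :: "'a::unital_cstar_algebra \<Rightarrow> 'a \<Rightarrow> real" where
  "a_numerical_radius a x = (SUP z\<in>a_numerical_range a x. cmod z)"

definition a_crawford_number :: "'a::unital_cstar_algebra \<Rightarrow> 'a \<Rightarrow> real" where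
  "a_crawford_number a x = (INF z\<in>a_numerical_range a x. cmod z)"

(* \<phi> (star x * a * x) is real and nonnegative for positive a and positive \<phi>. *)
definition a_seminorm :: "'a::unital_cstar_algebra \<Rightarrow> 'a \<Rightarrow> real" where
  "a_seminorm a x = (SUP \<phi>\<in>a_states a. sqrt (Re (\<phi> (star x * a * x))))"

definition is_a_adjoint :: "'a::unital_cstar_algebra \<Rightarrow> 'a \<Rightarrow> 'a \<Rightarrow> bool" where
  "is_a_adjoint a x y \<longleftrightarrow> star x * a = a * y"

definition a_adjointable :: "'a::unital_cstar_algebra \<Rightarrow> 'a set" where
  "a_adjointable a = {x. \<exists>y. is_a_adjoint a x y}"

end

(* Every a-state phi turns the algebra into a pre-Hilbert space with the form phi(u^* a v), on which
   left multiplication by x has left multiplication by an a-adjoint of x as its adjoint.  Buzano's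
   inequality in the p-weighted direct sum of k copies, together with
   4 P Q = (P + Q)^2 - (P - Q)^2 for P = sum p_j phi(a y_j x_j) and Q = sum p_j phi(a x_j y_j)
   (y_j the a-adjoint of x_j), bounds each |phi(a X)|^4.  The parameter mu costs nothing because
   v_a(sum p_j x_j^2) is at most half of sum p_j ||y_j x_j + x_j y_j||_a.

   The supremum v_a must not be over the empty set, so an a-state has to exist.  It comes from the
   Hahn-Banach theorem, whose functional is positive because every x^* x is positive
   (Fukamiya-Kaplansky); the spectral input is an elementary argument of Rickart showing that a
   self-adjoint element of norm r has spectrum on the circle of radius r. *)

theory Submission
  imports Defs "HOL-Computational_Algebra.Formal_Power_Series"
begin

subsection \<open>The involution\<close>

text \<open>Positivity is defined by the spectrum, where sums are awkward to handle. Spectral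
  positivity is therefore converted to membership in the norm-defined \<open>pos_cone\<close>, and
  there a binomial series, absolutely convergent even at norm 1, supplies square roots. Norm bounds
  come from the C*-identity for \<open>b + \<i> s\<close>, where \<open>b\<close> and
  \<open>s\<close> are commuting roots of complementary elements. Buzano's inequality bounds the
  product of the pairings of (x_j) with the unit vector (1) and of (1) with (y_j). Both pairings
  equal \<alpha> = phi(a X) with X = sum p_j x_j, while (x_j) and (y_j) pair to phi(a sum p_j
  x_j^2). So the inequality bounds |\<alpha>|^2, and squaring it yields the fourth power.
  Cauchy-Schwarz and the inequality of arithmetic and geometric means give the bound on v_a(sum p_j
  x_j^2) that absorbs \<mu>.\<close>

lemma scaleC_zero_right [simp]: "c *\<^sub>C (0::'a::unital_cstar_algebra) = 0"
  using scaleC_add_right[of c 0 "0::'a"] by simp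

lemma scaleC_zero_left [simp]: "0 *\<^sub>C (x::'a::unital_cstar_algebra) = 0"
  using scaleC_add_left[of 0 0 x] by simp

lemma scaleC_one [simp]: "1 *\<^sub>C (x::'a::unital_cstar_algebra) = x"
  using scaleC_of_real[of 1 x] by simp

lemma scaleC_minus_right [simp]: "c *\<^sub>C (- x) = - (c *\<^sub>C (x::'a::unital_cstar_algebra))"
  using scaleC_add_right[of c x "-x"] by (simp add: eq_neg_iff_add_eq_0 add.commute)

lemma scaleC_minus_left [simp]: "(- c) *\<^sub>C x = - (c *\<^sub>C (x::'a::unital_cstar_algebra))"
  using scaleC_add_left[of c "-c" x] by (simp add: eq_neg_iff_add_eq_0 add.commute)

lemma scaleC_diff_right: "c *\<^sub>C (x - y) = c *\<^sub>C x - c *\<^sub>C (y::'a::unital_cstar_algebra)"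
  using scaleC_add_right[of c x "-y"] by simp

lemma scaleC_diff_left: "(c - d) *\<^sub>C x = c *\<^sub>C x - d *\<^sub>C (x::'a::unital_cstar_algebra)"
  using scaleC_add_left[of c "-d" x] by simp

lemma scaleC_scaleR: "c *\<^sub>C (r *\<^sub>R x) = r *\<^sub>R (c *\<^sub>C (x::'a::unital_cstar_algebra))"
  by (metis mult.commute scaleC_of_real scaleC_scaleC)

lemma star_zero [simp]: "star (0::'a::unital_cstar_algebra) = 0"
  using star_add[of 0 "0::'a"] by simp

lemma star_minus: "star (- x) = - star (x::'a::unital_cstar_algebra)"
  using star_add[of x "-x"] by (simp add: eq_neg_iff_add_eq_0 add.commute)

lemma star_diff: "star (x - y) = star x - star (y::'a::unital_cstar_algebra)"
  using star_add[of x "-y"] by (simp add: star_minus)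

lemma star_one [simp]: "star (1::'a::unital_cstar_algebra) = 1"
  by (metis mult.left_neutral mult.right_neutral star_mult star_star)

lemma star_scaleR: "star (r *\<^sub>R x) = r *\<^sub>R star (x::'a::unital_cstar_algebra)"
  using star_scaleC[of "of_real r" x] by (simp add: scaleC_of_real)

lemma star_power: "star (x ^ n) = star (x::'a::unital_cstar_algebra) ^ n"
  by (induction n) (simp_all add: star_mult power_commutes)

lemma norm_star [simp]: "norm (star x) = norm (x::'a::unital_cstar_algebra)"
proof -
  have "norm y \<le> norm (star y)" for y :: 'a
  proof (cases "y = 0")
    case False
    have "norm y * norm y \<le> norm (star y) * norm y"
      using norm_mult_ineq[of "star y" y] by (simp add: cstar_identity power2_eq_square)
    with False show ?thesis by simp
  qed auto
  from this[of x] this[of "star x"] show ?thesis by (simp add: star_star)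
qed

lemma bounded_linear_star: "bounded_linear (star :: 'a::unital_cstar_algebra \<Rightarrow> 'a)"
  by (rule bounded_linear_intro[where K=1]) (simp_all add: star_add star_scaleR)

lemma norm_selfadjoint_square: "star x = x \<Longrightarrow> norm (x * x) = (norm (x::'a::unital_cstar_algebra))\<^sup>2"
  using cstar_identity[of x] by simp

text \<open>The C*-identity controls squares, which gives exact norms at exponents that are powers
  of two. This is why the resolvent argument below doubles its exponent at each stage.\<close>

lemma norm_selfadjoint_power:
  assumes "star x = (x::'a::unital_cstar_algebra)"
  shows "norm (x ^ (2 ^ m)) = norm x ^ (2 ^ m)"
proof (induction m)
  case (Suc m)
  have "x ^ (2 ^ Suc m) = x ^ (2 ^ m) * x ^ (2 ^ m)"
    by (simp add: power_add[symmetric] mult_2)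
  then show ?case
    using Suc assms norm_selfadjoint_square[of "x ^ (2 ^ m)"]
    by (simp add: star_power power2_eq_square mult_2 power_add)
qed simp

subsection \<open>Invertible elements and the spectral radius of a self-adjoint element\<close>

definition invertible_elem :: "'a::monoid_mult \<Rightarrow> bool" where
  "invertible_elem x \<longleftrightarrow> (\<exists>y. x * y = 1 \<and> y * x = 1)"

lemma invertible_elem_scaleC:
  assumes "invertible_elem (x::'a::unital_cstar_algebra)" "c \<noteq> 0"
  shows "invertible_elem (c *\<^sub>C x)"
proof -
  obtain y where "x * y = 1" "y * x = 1" using assms by (auto simp: invertible_elem_def)
  then have "(c *\<^sub>C x) * (inverse c *\<^sub>C y) = 1" "(inverse c *\<^sub>C y) * (c *\<^sub>C x) = 1"
    using assms(2) by (simp_all add: scaleC_mult_left scaleC_mult_right scaleC_scaleC)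
  then show ?thesis by (auto simp: invertible_elem_def)
qed

lemma invertible_elem_one_minus:
  fixes x :: "'a::{real_normed_algebra_1, banach}"
  assumes "norm x < 1"
  shows "invertible_elem (1 - x)"
proof -
  have "summable (\<lambda>n. norm x ^ n)" using assms by simp
  then have s: "summable (\<lambda>n. x ^ n)"
    by (rule summable_comparison_test'[where N=0]) (simp add: norm_power_ineq)
  define y where "y = (\<Sum>n. x ^ n)"
  have "y = (\<Sum>n. x ^ Suc n) + 1"
    using suminf_split_head[OF s] by (simp add: y_def)
  moreover have "(\<Sum>n. x ^ Suc n) = x * y"
    using suminf_mult[OF s] by (simp add: y_def)
  moreover have "(\<Sum>n. x ^ Suc n) = y * x"
    using suminf_mult2[OF s] by (simp add: y_def power_commutes)
  ultimately have "(1 - x) * y = 1" "y * (1 - x) = 1" by (simp_all add: algebra_simps)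
  then show ?thesis by (auto simp: invertible_elem_def)
qed

lemma invertible_elem_scaleC_one_minus:
  fixes x :: "'a::unital_cstar_algebra"
  assumes "norm x < cmod c"
  shows "invertible_elem (c *\<^sub>C 1 - x)"
proof -
  have c: "c \<noteq> 0" using assms norm_ge_zero[of x] by auto
  have "invertible_elem (1 - inverse c *\<^sub>C x)"
    using assms c by (intro invertible_elem_one_minus) (simp add: norm_scaleC norm_inverse norm_divide divide_simps mult.commute)
  from invertible_elem_scaleC[OF this c] c show ?thesis
    by (simp add: scaleC_diff_right scaleC_scaleC)
qed

lemma invertible_elem_commuting_factor:
  assumes "invertible_elem (x * y)" "x * y = y * x"
  shows "invertible_elem (x::'a::monoid_mult)"
proof -
  obtain w where w: "x * y * w = 1" "w * (x * y) = 1"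
    using assms by (auto simp: invertible_elem_def)
  have "w * y * x = 1" using w assms by (simp add: mult.assoc)
  moreover have "x * (y * w) = 1" using w by (simp add: mult.assoc)
  ultimately have "x * (y * w) = 1" "y * w * x = 1"
    by (metis mult.assoc mult.left_neutral mult.right_neutral)+
  then show ?thesis unfolding invertible_elem_def by blast
qed

text \<open>The inverse \<open>1 + y * w * x\<close> is suggested by the formal geometric series:
  the powers of \<open>y * x\<close> sum to 1 plus \<open>y\<close> times the sum of the powers of
  \<open>x * y\<close> times \<open>x\<close>.\<close>

lemma invertible_elem_one_minus_swap:
  assumes "invertible_elem (1 - x * y)"
  shows "invertible_elem (1 - y * (x::'a::ring_1))"
proof -
  obtain w where w: "(1 - x * y) * w = 1" "w * (1 - x * y) = 1"
    using assms by (auto simp: invertible_elem_def)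
  then have "x * y * w = w - 1" "w * x * y = w - 1" by (simp_all add: algebra_simps)
  then have e: "y * x * (y * w * x) = y * (w - 1) * x" "y * w * x * (y * x) = y * (w - 1) * x"
    by (metis mult.assoc)+
  have "(1 - y * x) * (1 + y * w * x) = 1" "(1 + y * w * x) * (1 - y * x) = 1"
    using e by (simp_all add: algebra_simps)
  then show ?thesis unfolding invertible_elem_def by blast
qed

section \<open>Rickart's resolvent argument\<close>

lemma scaleC_mult_both: "(c *\<^sub>C x) * (d *\<^sub>C y) = (c * d) *\<^sub>C (x * (y::'a::unital_cstar_algebra))"
  by (simp add: scaleC_mult_left scaleC_mult_right scaleC_scaleC mult.commute)

lemma scaleC_power: "(c *\<^sub>C x) ^ n = (c ^ n) *\<^sub>C (x::'a::unital_cstar_algebra) ^ n"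
  by (induction n) (simp_all add: scaleC_mult_both)

text \<open>The resolvent identity \<open>R w - R z = R w * ((w - z) *\<^sub>C c) * R z\<close>
  turns a uniform bound for \<open>R\<close> on the closed disc into a Lipschitz constant. The bound
  comes from compactness, so continuity has to be shown first.\<close>

lemma resolvent_lipschitz:
  fixes c :: "'a::unital_cstar_algebra"
  assumes "\<And>z. cmod z \<le> 1 \<Longrightarrow> invertible_elem (1 - z *\<^sub>C c)"
  obtains R :: "complex \<Rightarrow> 'a" and L :: real where
    "\<And>z. cmod z \<le> 1 \<Longrightarrow> (1 - z *\<^sub>C c) * R z = 1"
    "\<And>z. cmod z \<le> 1 \<Longrightarrow> R z * (1 - z *\<^sub>C c) = 1"
    "\<And>z w. cmod z \<le> 1 \<Longrightarrow> cmod w \<le> 1 \<Longrightarrow> norm (R z - R w) \<le> L * cmod (z - w)" "L \<ge> 0"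
proof -
  have "\<exists>R. \<forall>z. cmod z \<le> 1 \<longrightarrow> (1 - z *\<^sub>C c) * R z = 1 \<and> R z * (1 - z *\<^sub>C c) = 1"
    using assms unfolding invertible_elem_def by (intro choice) blast
  then obtain R where R: "\<And>z. cmod z \<le> 1 \<Longrightarrow> (1 - z *\<^sub>C c) * R z = 1"
    "\<And>z. cmod z \<le> 1 \<Longrightarrow> R z * (1 - z *\<^sub>C c) = 1" by blast
  have res: "norm (R w - R z) \<le> cmod (w - z) * (norm (R w) * norm c * norm (R z))"
    if "cmod z \<le> 1" "cmod w \<le> 1" for z w
  proof -
    have "R w - R z = R w * ((1 - z *\<^sub>C c) * R z) - R w * (1 - w *\<^sub>C c) * R z"
      using R that by simp
    also have "\<dots> = R w * ((w - z) *\<^sub>C c) * R z"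
      by (simp add: algebra_simps scaleC_diff_left)
    also have "norm \<dots> \<le> norm (R w) * norm ((w - z) *\<^sub>C c) * norm (R z)"
      by (meson norm_mult_ineq mult_right_mono norm_ge_zero order_trans)
    finally show ?thesis by (simp add: norm_scaleC mult_ac)
  qed
  have "continuous_on (cball 0 1) R"
    unfolding continuous_on_iff
  proof (intro ballI allI impI)
    fix z :: complex and e :: real assume z: "z \<in> cball 0 1" and e: "e > 0"
    define N where "N = norm (R z)"
    define K where "K = N * norm c + 1"
    define M where "M = 2 * N * norm c * N + 1"
    have K: "K > 0" and M: "M > 0" and N: "N \<ge> 0"
      unfolding K_def M_def N_def by (simp_all add: add_nonneg_pos)
    \<comment> \<open>The first term makes the resolvent estimate at most half of
      \<open>norm (R w)\<close>, hence \<open>norm (R w) \<le> 2 * N\<close>; with that bound the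
      second term gives a distance below \<open>e\<close>.\<close>
    define d where "d = min (1 / (2 * K)) (e / M)"
    have "d > 0" using K M e by (simp add: d_def)
    moreover have "dist (R w) (R z) < e" if w: "w \<in> cball 0 1" and wz: "dist w z < d" for w
    proof -
      have b: "norm (R w - R z) \<le> cmod (w - z) * (norm (R w) * norm c * N)"
        using res[of z w] z w by (simp add: N_def)
      have "cmod (w - z) * (norm c * N) \<le> 1 / (2 * K) * K"
        using wz K N by (intro mult_mono) (auto simp: d_def dist_norm K_def mult.commute)
      then have h: "cmod (w - z) * (norm c * N) \<le> 1 / 2" using K by simp
      have "norm (R w) * (cmod (w - z) * (norm c * N)) \<le> norm (R w) * (1 / 2)"
        using h by (rule mult_left_mono) simp
      then have "norm (R w - R z) \<le> norm (R w) / 2" using b by (simp add: mult_ac)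
      moreover have "norm (R w) \<le> norm (R w - R z) + N"
        using norm_triangle_ineq[of "R w - R z" "R z"] by (simp add: N_def)
      ultimately have "norm (R w) \<le> 2 * N" by simp
      then have "norm (R w) * norm c * N \<le> 2 * N * norm c * N"
        using N by (intro mult_right_mono) auto
      then have "cmod (w - z) * (norm (R w) * norm c * N) \<le> cmod (w - z) * M"
        by (intro mult_left_mono) (auto simp: M_def)
      also have "\<dots> < e / M * M"
        using wz M by (intro mult_strict_right_mono) (auto simp: d_def dist_norm)
      finally show ?thesis using b M by (simp add: dist_norm)
    qed
    ultimately show "\<exists>d>0. \<forall>w\<in>cball 0 1. dist w z < d \<longrightarrow> dist (R w) (R z) < e" by blast
  qed
  then have "bounded (R ` cball 0 1)"
    by (intro compact_imp_bounded compact_continuous_image) auto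
  then obtain B where B: "\<And>z. cmod z \<le> 1 \<Longrightarrow> norm (R z) \<le> B" 
    unfolding bounded_iff by (metis imageI mem_cball_0)
  have B0: "B \<ge> 0" using B[of 0] norm_ge_zero[of "R 0"] by (simp del: norm_ge_zero)
  show thesis
  proof (rule that[of R "B * norm c * B"])
    fix z w :: complex assume *: "cmod z \<le> 1" "cmod w \<le> 1"
    have "norm (R z - R w) \<le> cmod (z - w) * (norm (R z) * norm c * norm (R w))"
      using res * by blast
    also have "\<dots> \<le> cmod (z - w) * (B * norm c * B)"
      using B * B0 by (intro mult_left_mono mult_mono) auto
    finally show "norm (R z - R w) \<le> B * norm c * B * cmod (z - w)" by (simp add: mult_ac)
  qed (use R B0 in auto)
qed

text \<open>Averaging the resolvents at \<open>z\<close> and \<open>\<omega>z\<close>, where \<open>\<omega>\<close> is a root of \<open>-1\<close>,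
  doubles the exponent without increasing the Lipschitz constant.\<close>

lemma power_resolvent_lipschitz:
  fixes c :: "'a::unital_cstar_algebra"
  assumes R: "\<And>z. cmod z \<le> 1 \<Longrightarrow> (1 - z *\<^sub>C c) * R z = 1"
    "\<And>z. cmod z \<le> 1 \<Longrightarrow> R z * (1 - z *\<^sub>C c) = 1"
    "\<And>z w. cmod z \<le> 1 \<Longrightarrow> cmod w \<le> 1 \<Longrightarrow> norm (R z - R w) \<le> L * cmod (z - w)"
  shows "\<exists>g. (\<forall>z. cmod z \<le> 1 \<longrightarrow> (1 - (z *\<^sub>C c) ^ (2 ^ m)) * g z = 1 \<and> g z * (1 - (z *\<^sub>C c) ^ (2 ^ m)) = 1)
    \<and> (\<forall>z w. cmod z \<le> 1 \<longrightarrow> cmod w \<le> 1 \<longrightarrow> norm (g z - g w) \<le> L * cmod (z - w))"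
proof (induction m)
  case 0
  show ?case using R by (intro exI[of _ R]) auto
next
  case (Suc m)
  define n :: nat where "n = 2 ^ m"
  obtain g where g: "\<And>z. cmod z \<le> 1 \<Longrightarrow> (1 - (z *\<^sub>C c) ^ n) * g z = 1"
     "\<And>z. cmod z \<le> 1 \<Longrightarrow> g z * (1 - (z *\<^sub>C c) ^ n) = 1"
     "\<And>z w. cmod z \<le> 1 \<Longrightarrow> cmod w \<le> 1 \<Longrightarrow> norm (g z - g w) \<le> L * cmod (z - w)"
    using Suc unfolding n_def by blast
  define \<omega> where "\<omega> = cis (pi / n)"
  have [simp]: "cmod \<omega> = 1" by (simp add: \<omega>_def)
  have "n > 0" by (simp add: n_def)
  then have "real n * (pi / n) = pi" by simp
  then have "cis (pi / n) ^ n = cis pi" by (subst Complex.DeMoivre) (rule arg_cong)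
  then have \<omega>n: "\<omega> ^ n = -1" unfolding \<omega>_def by simp
  define g' where "g' z = (1/2) *\<^sub>R (g z + g (\<omega> * z))" for z
  have "(1 - (z *\<^sub>C c) ^ (2 ^ Suc m)) * g' z = 1 \<and> g' z * (1 - (z *\<^sub>C c) ^ (2 ^ Suc m)) = 1"
    if z: "cmod z \<le> 1" for z
  proof -
    define u where "u = (z *\<^sub>C c) ^ n"
    define p where "p = g z"
    define q where "q = g (\<omega> * z)"
    have z': "cmod (\<omega> * z) \<le> 1" using z by (simp add: norm_mult)
    have u': "((\<omega> * z) *\<^sub>C c) ^ n = - u"
      using \<omega>n by (simp add: u_def scaleC_power power_mult_distrib)
    have uu: "(z *\<^sub>C c) ^ (2 ^ Suc m) = u * u"
      by (simp add: u_def n_def power_add[symmetric] mult_2)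
    have p1: "(1 - u) * p = 1" "p * (1 - u) = 1" using g z by (simp_all add: u_def p_def)
    have q1: "(1 + u) * q = 1" "q * (1 + u) = 1" using g(1,2)[OF z'] u' by (simp_all add: q_def)
    \<comment> \<open>Partial fractions: \<open>p\<close> and \<open>q\<close> invert
      \<open>1 - u\<close> and \<open>1 + u\<close>, so \<open>p + q\<close> is twice the inverse of
      \<open>1 - u * u\<close>.\<close>
    have f: "1 - u * u = (1 + u) * (1 - u)" "1 - u * u = (1 - u) * (1 + u)"
      by (simp_all add: algebra_simps)
    have "(1 - u * u) * p = 1 + u" using p1 unfolding f(1) by (simp add: mult.assoc)
    moreover have "(1 - u * u) * q = 1 - u" using q1 unfolding f(2) by (simp add: mult.assoc)
    moreover have "p * (1 - u * u) = 1 + u"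
      using p1 unfolding f(2) by (simp add: mult.assoc[symmetric])
    moreover have "q * (1 - u * u) = 1 - u"
      using q1 unfolding f(1) by (simp add: mult.assoc[symmetric])
    ultimately have "(1 - u * u) * (p + q) = 2" "(p + q) * (1 - u * u) = 2"
      by (simp_all add: distrib_left distrib_right)
    moreover have "(1/2) *\<^sub>R (2::'a) = 1" 
      by (metis scaleR_conv_of_real of_real_numeral of_real_mult[symmetric] of_real_1
          nonzero_divide_eq_eq zero_neq_numeral)
    ultimately show ?thesis
      unfolding uu g'_def p_def[symmetric] q_def[symmetric]
      by (simp add: mult_scaleR_right mult_scaleR_left)
  qed
  moreover have "norm (g' z - g' w) \<le> L * cmod (z - w)" if z: "cmod z \<le> 1" "cmod w \<le> 1" for z w
  proof -
    have "g' z - g' w = (1/2) *\<^sub>R ((g z - g w) + (g (\<omega> * z) - g (\<omega> * w)))"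
      by (simp add: g'_def algebra_simps)
    then have "norm (g' z - g' w) \<le> (norm (g z - g w) + norm (g (\<omega> * z) - g (\<omega> * w))) / 2"
      using norm_triangle_ineq[of "g z - g w" "g (\<omega> * z) - g (\<omega> * w)"] by simp
    moreover have "norm (g z - g w) \<le> L * cmod (z - w)" using g(3) z by blast
    moreover have "norm (g (\<omega> * z) - g (\<omega> * w)) \<le> L * cmod (\<omega> * z - \<omega> * w)"
      using z by (intro g(3)) (auto simp: norm_mult)
    moreover have "cmod (\<omega> * z - \<omega> * w) = cmod (z - w)"
      by (simp add: norm_mult flip: right_diff_distrib)
    ultimately show ?thesis by simp
  qed
  ultimately show ?case by (intro exI[of _ g']) blast
qed

text \<open>If all these elements were invertible, the inverses \<open>g z\<close> of
  \<open>1 - (z *\<^sub>C c) ^ n\<close> for \<open>n = 2 ^ m\<close> would share one Lipschitz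
  constant. At a fixed \<open>s < 1\<close> the power is tiny for large \<open>n\<close>, so
  \<open>g s\<close> is near 1, and hence so is \<open>g 1\<close>; but
  \<open>norm (c ^ n) = 1\<close>.\<close>

lemma selfadjoint_norm_one_spectrum:
  fixes c :: "'a::unital_cstar_algebra"
  assumes sa: "star c = c" and c: "norm c = 1"
  shows "\<exists>z. cmod z \<le> 1 \<and> \<not> invertible_elem (1 - z *\<^sub>C c)"
proof (rule ccontr)
  assume "\<not> ?thesis"
  then have "\<And>z. cmod z \<le> 1 \<Longrightarrow> invertible_elem (1 - z *\<^sub>C c)" by blast
  then obtain R :: "complex \<Rightarrow> 'a" and L :: real where R:
    "\<And>z. cmod z \<le> 1 \<Longrightarrow> (1 - z *\<^sub>C c) * R z = 1"
    "\<And>z. cmod z \<le> 1 \<Longrightarrow> R z * (1 - z *\<^sub>C c) = 1"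
    "\<And>z w. cmod z \<le> 1 \<Longrightarrow> cmod w \<le> 1 \<Longrightarrow> norm (R z - R w) \<le> L * cmod (z - w)" "L \<ge> 0"
    using resolvent_lipschitz by metis
  \<comment> \<open>Going from \<open>s\<close> to 1 costs at most 1/6. The bound
    \<open>s ^ n \<le> 1 / 7\<close> costs another 1/6, from
    \<open>norm (G - 1) \<le> (norm (G - 1) + 1) / 7\<close>. The total 1/3 is below 1/2, which is
    what the contradiction requires.\<close>
  define s where "s = 1 - 1 / (6 * (L + 1))"
  have s: "0 < s" "s < 1" "L * (1 - s) \<le> 1 / 6" using R(4) by (simp_all add: s_def field_simps)
  obtain m0 where m0: "s ^ m0 < 1 / 7" using real_arch_pow_inv[of "1/7" s] s by auto
  define n :: nat where "n = 2 ^ m0"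
  have "m0 \<le> n" using less_exp[of m0] by (simp add: n_def)
  then have sn: "s ^ n \<le> 1 / 7"
    using power_decreasing[of m0 n s] s m0 by linarith
  obtain g where g: "\<And>z. cmod z \<le> 1 \<Longrightarrow> g z * (1 - (z *\<^sub>C c) ^ n) = 1"
     "\<And>z w. cmod z \<le> 1 \<Longrightarrow> cmod w \<le> 1 \<Longrightarrow> norm (g z - g w) \<le> L * cmod (z - w)"
    using power_resolvent_lipschitz[OF R(1-3), of m0] unfolding n_def by blast
  define u where "u = (of_real s *\<^sub>C c) ^ n"
  have u: "norm u \<le> 1 / 7"
  proof -
    have "norm u \<le> norm (of_real s *\<^sub>C c) ^ n" unfolding u_def by (rule norm_power_ineq)
    also have "\<dots> = s ^ n" using s c by (simp add: norm_scaleC)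
    finally show ?thesis using sn by simp
  qed
  define G where "G = g (of_real s)"
  have "G * (1 - u) = 1" unfolding G_def u_def using s by (intro g) simp
  then have G: "G - 1 = G * u" by (simp add: algebra_simps)
  have "norm (G - 1) \<le> norm G * (1/7)"
    unfolding G using norm_mult_ineq[of G u] u by (meson mult_left_mono norm_ge_zero order_trans)
  moreover have "norm G \<le> norm (G - 1) + 1" using norm_triangle_ineq[of "G - 1" 1] by simp
  ultimately have "norm (G - 1) \<le> 1 / 6" by simp
  moreover have "norm (g 1 - G) \<le> 1 / 6"
  proof -
    have "norm (g 1 - G) \<le> L * cmod (1 - of_real s)"
      unfolding G_def using s by (intro g(2)) auto
    also have "cmod (1 - of_real s) = 1 - s"
      using s by (metis abs_of_nonneg diff_ge_0_iff_ge less_imp_le norm_of_real of_real_1 of_real_diff)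
    finally show ?thesis using s by simp
  qed
  ultimately have g1: "norm (g 1 - 1) \<le> 1 / 3"
    using norm_triangle_ineq[of "g 1 - G" "G - 1"] by simp
  have un: "norm (c ^ n) = 1"
    unfolding n_def using norm_selfadjoint_power[OF sa, of m0] c by simp
  have "g 1 * (1 - c ^ n) = 1" using g(1)[of 1] by simp
  then have "c ^ n = (g 1 - 1) - (g 1 - 1) * c ^ n" by (simp add: algebra_simps)
  then have "norm (c ^ n) \<le> norm (g 1 - 1) + norm ((g 1 - 1) * c ^ n)"
    using norm_triangle_ineq4 by metis
  also have "\<dots> \<le> norm (g 1 - 1) + norm (g 1 - 1) * norm (c ^ n)"
    by (intro add_left_mono norm_mult_ineq)
  finally show False using g1 un by simp
qed

subsection \<open>The positive cone and square roots\<close>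

text \<open>A norm description of positivity, for which closure under sums is immediate.\<close>

definition pos_cone :: "'a::unital_cstar_algebra set" where
  "pos_cone = {h. star h = h \<and> (\<exists>t\<ge>0. norm (t *\<^sub>R 1 - h) \<le> t)}"

lemma pos_cone_selfadjoint: "h \<in> pos_cone \<Longrightarrow> star h = h"
  by (simp add: pos_cone_def)

lemma pos_coneI: "star h = h \<Longrightarrow> norm (t *\<^sub>R 1 - h) \<le> t \<Longrightarrow> h \<in> pos_cone"
  unfolding pos_cone_def using order.trans[OF norm_ge_zero] by blast

lemma pos_cone_zero [simp]: "0 \<in> pos_cone"
  by (rule pos_coneI[where t=0]) auto

lemma pos_cone_add:
  assumes "h \<in> pos_cone" "k \<in> pos_cone"
  shows "h + k \<in> (pos_cone :: 'a::unital_cstar_algebra set)"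
proof -
  obtain s t where "norm (s *\<^sub>R 1 - h) \<le> s" "norm (t *\<^sub>R 1 - k) \<le> t"
    using assms by (auto simp: pos_cone_def)
  then have "norm ((s *\<^sub>R 1 - h) + (t *\<^sub>R 1 - k)) \<le> s + t"
    by (rule norm_triangle_mono)
  moreover have "(s *\<^sub>R 1 - h) + (t *\<^sub>R 1 - k) = (s + t) *\<^sub>R 1 - (h + k)"
    by (simp add: algebra_simps)
  ultimately show ?thesis
    using assms by (metis pos_coneI pos_cone_selfadjoint star_add)
qed

lemma pos_cone_scaleR:
  assumes "h \<in> pos_cone" "r \<ge> 0"
  shows "r *\<^sub>R h \<in> (pos_cone :: 'a::unital_cstar_algebra set)"
proof -
  obtain t where t: "norm (t *\<^sub>R 1 - h) \<le> t"
    using assms by (auto simp: pos_cone_def)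
  have "(r * t) *\<^sub>R 1 - r *\<^sub>R h = r *\<^sub>R (t *\<^sub>R 1 - h)" by (simp add: algebra_simps)
  then show ?thesis using assms t
    by (intro pos_coneI[where t="r * t"]) (simp_all add: star_scaleR pos_cone_selfadjoint mult_left_mono)
qed

lemma pos_cone_diff:
  "star h = h \<Longrightarrow> norm h \<le> r \<Longrightarrow> r *\<^sub>R 1 - h \<in> (pos_cone :: 'a::unital_cstar_algebra set)"
  by (rule pos_coneI[where t=r]) (simp_all add: star_diff star_scaleR)

section \<open>Square roots from the Taylor series of sqrt(1 - t)\<close>

definition sqrt_coeff :: "nat \<Rightarrow> real" where
  "sqrt_coeff n = (-1) ^ n * (1 / 2 gchoose n)"

lemma sqrt_coeff_0 [simp]: "sqrt_coeff 0 = 1"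
  by (simp add: sqrt_coeff_def)

lemma sqrt_coeff_Suc: "sqrt_coeff (Suc n) = sqrt_coeff n * (real n - 1 / 2) / (real n + 1)"
proof -
  have e: "(1 / 2 gchoose Suc n :: real) = (1 / 2 gchoose n) * (1 / 2 - real n) / (real n + 1)"
    using gbinomial_mult_1[of "1/2 :: real" n] by (simp add: field_simps)
  show ?thesis unfolding sqrt_coeff_def e by (simp add: field_simps)
qed

lemma sqrt_coeff_nonpos: "sqrt_coeff (Suc n) \<le> 0"
proof (induction n)
  case 0
  show ?case by (simp add: sqrt_coeff_Suc)
next
  case (Suc n)
  have "sqrt_coeff (Suc n) * ((real (Suc n) - 1 / 2) / (real (Suc n) + 1)) \<le> 0"
    using Suc by (intro mult_nonpos_nonneg) auto
  then show ?case by (subst sqrt_coeff_Suc) simp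
qed

text \<open>These partial sums are the Taylor coefficients of sqrt(1 - t) / (1 - t), that is of 1 -
  t to the power -1/2, all of which are positive. As every coefficient after the first is
  nonpositive, the absolute values of the later ones sum to at most 1.\<close>

lemma sum_sqrt_coeff_nonneg: "(\<Sum>k\<le>n. sqrt_coeff k) \<ge> 0"
proof -
  have "(\<Sum>k\<le>n. sqrt_coeff k) = (-1) ^ n * (- 1 / 2 gchoose n)"
    using gbinomial_sum_lower_neg[of "1 / 2 :: real" n] by (simp add: sqrt_coeff_def mult.commute)
  also have "\<dots> \<ge> 0"
  proof (induction n)
    case (Suc n)
    have e: "(- 1 / 2 gchoose Suc n :: real) = (- 1 / 2 gchoose n) * (- 1 / 2 - real n) / (real n + 1)"
      using gbinomial_mult_1[of "- 1/2 :: real" n] by (simp add: field_simps)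
    have "(- 1) ^ Suc n * (- 1 / 2 gchoose Suc n :: real)
        = (- 1) ^ n * (- 1 / 2 gchoose n) * ((1 / 2 + real n) / (real n + 1))"
      unfolding e by (simp add: field_simps)
    also have "\<dots> \<ge> 0" by (intro mult_nonneg_nonneg[OF Suc]) auto
    finally show ?case .
  qed simp
  finally show ?thesis .
qed

lemma sqrt_coeff_summable: "summable (\<lambda>n. \<bar>sqrt_coeff n\<bar>)"
  and suminf_sqrt_coeff_Suc: "(\<Sum>n. \<bar>sqrt_coeff (Suc n)\<bar>) \<le> 1"
proof -
  have b: "(\<Sum>k<n. \<bar>sqrt_coeff (Suc k)\<bar>) \<le> 1" for n
  proof -
    have "(\<Sum>k<n. \<bar>sqrt_coeff (Suc k)\<bar>) = - (\<Sum>k<n. sqrt_coeff (Suc k))"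
      by (simp add: sqrt_coeff_nonpos abs_of_nonpos sum_negf)
    moreover have "(\<Sum>k\<le>n. sqrt_coeff k) = 1 + (\<Sum>k<n. sqrt_coeff (Suc k))"
      by (simp add: sum.atMost_shift)
    ultimately show ?thesis using sum_sqrt_coeff_nonneg[of n] by simp
  qed
  have s: "summable (\<lambda>n. \<bar>sqrt_coeff (Suc n)\<bar>)"
    by (rule summableI_nonneg_bounded[where x=1]) (use b in auto)
  show "summable (\<lambda>n. \<bar>sqrt_coeff n\<bar>)"
    using s by (subst (asm) summable_Suc_iff)
  show "(\<Sum>n. \<bar>sqrt_coeff (Suc n)\<bar>) \<le> 1"
    using s b by (intro suminf_le_const) auto
qed

lemma sqrt_coeff_convolution:
  "(\<Sum>i\<le>n. sqrt_coeff i * sqrt_coeff (n - i)) = (if n = 0 then 1 else if n = 1 then -1 else 0)"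
proof -
  have "(\<Sum>i\<le>n. sqrt_coeff i * sqrt_coeff (n - i))
      = (-1) ^ n * (\<Sum>i\<le>n. (1 / 2 gchoose i) * (1 / 2 gchoose (n - i)))"
    unfolding sum_distrib_left
    by (rule sum.cong) (simp_all add: sqrt_coeff_def mult_ac flip: power_add)
  also have "(\<Sum>i\<le>n. (1 / 2 gchoose i) * (1 / 2 gchoose (n - i))) = (1 gchoose n :: real)"
    using gbinomial_Vandermonde[of "1 / 2 :: real" "1 / 2" n] by (simp add: atMost_atLeast0)
  also have "(1 gchoose n :: real) = of_nat (1 choose n)"
    by (simp add: binomial_gbinomial)
  finally show ?thesis by (cases n) (auto simp: binomial_eq_0)
qed

text \<open>The series is evaluated at \<open>c\<close>. The bound on \<open>norm (1 - b)\<close> is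
  what places \<open>b\<close> in \<open>pos_cone\<close>, and the commutation clause later allows
  roots of different elements to be combined.\<close>

lemma sqrt_one_minus:
  fixes c :: "'a::unital_cstar_algebra"
  assumes sa: "star c = c" and c: "norm c \<le> 1"
  obtains b where "star b = b" "b * b = 1 - c" "norm (1 - b) \<le> 1"
    "\<And>d. d * c = c * d \<Longrightarrow> d * b = b * d"
proof -
  define f where "f n = sqrt_coeff n *\<^sub>R c ^ n" for n
  have nf: "norm (f n) \<le> \<bar>sqrt_coeff n\<bar>" for n
  proof -
    have "norm (c ^ n) \<le> 1" using norm_power_ineq[of c n] power_le_one[of "norm c" n] c by simp
    then show ?thesis by (simp add: f_def mult_left_le)
  qed
  have sn: "summable (\<lambda>n. norm (f n))"
    using sqrt_coeff_summable by (rule summable_comparison_test'[where N=0]) (use nf in auto)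
  then have s: "summable f" by (rule summable_norm_cancel)
  define b where "b = (\<Sum>n. f n)"
  have "star b = (\<Sum>n. star (f n))"
    unfolding b_def by (rule bounded_linear.suminf[OF bounded_linear_star s])
  also have "\<dots> = b" by (simp add: f_def star_scaleR star_power sa b_def)
  finally have 1: "star b = b" .
  have conv: "(\<Sum>i\<le>n. f i * f (n - i)) = (\<Sum>i\<le>n. sqrt_coeff i * sqrt_coeff (n - i)) *\<^sub>R c ^ n" for n
    unfolding scaleR_sum_left
    by (rule sum.cong) (simp_all add: f_def flip: power_add)
  have "(\<lambda>n. \<Sum>i\<le>n. f i * f (n - i)) sums (b * b)"
    unfolding b_def using sn sn by (rule Cauchy_product_sums)
  moreover have "(\<lambda>n. \<Sum>i\<le>n. f i * f (n - i)) sums (\<Sum>n\<in>{0,1}. \<Sum>i\<le>n. f i * f (n - i))"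
    by (rule sums_finite) (auto simp: conv sqrt_coeff_convolution)
  moreover have "(\<Sum>n\<in>{0,1}. \<Sum>i\<le>n. f i * f (n - i)) = 1 - c"
    unfolding conv sqrt_coeff_convolution by simp
  ultimately have 2: "b * b = 1 - c" using sums_unique2 by metis
  have "b = (\<Sum>n. f (Suc n)) + 1" using suminf_split_head[OF s] by (simp add: b_def) (simp add: f_def)
  then have "norm (1 - b) = norm (\<Sum>n. f (Suc n))" by (simp add: norm_minus_commute)
  also have "\<dots> \<le> (\<Sum>n. norm (f (Suc n)))"
    using sn by (intro summable_norm) (subst summable_Suc_iff)
  also have "\<dots> \<le> (\<Sum>n. \<bar>sqrt_coeff (Suc n)\<bar>)"
    using sn sqrt_coeff_summable nf
    by (intro suminf_le) (auto simp: summable_Suc_iff[of "\<lambda>n. norm (f n)"]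
        summable_Suc_iff[of "\<lambda>n. \<bar>sqrt_coeff n\<bar>"])
  also have "\<dots> \<le> 1" by (rule suminf_sqrt_coeff_Suc)
  finally have 3: "norm (1 - b) \<le> 1" .
  have "d * b = b * d" if "d * c = c * d" for d
  proof -
    have "d * c ^ n = c ^ n * d" for n
      by (induction n) (simp_all add: that mult.assoc, metis mult.assoc that)
    then have "d * f n = f n * d" for n by (simp add: f_def)
    then show ?thesis using suminf_mult[OF s, of d] suminf_mult2[OF s, of d] by (simp add: b_def)
  qed
  then show thesis using that 1 2 3 by blast
qed

lemma pos_cone_sqrt:
  fixes h :: "'a::unital_cstar_algebra"
  assumes "h \<in> pos_cone"
  obtains b where "b \<in> pos_cone" "b * b = h" "\<And>d. d * h = h * d \<Longrightarrow> d * b = b * d"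
proof -
  obtain t where t: "t \<ge> 0" "norm (t *\<^sub>R 1 - h) \<le> t" and sa: "star h = h"
    using assms by (auto simp: pos_cone_def)
  show thesis
  proof (cases "t = 0")
    case True
    then show thesis using t that[of 0] by simp
  next
    case False
    define c where "c = 1 - (1 / t) *\<^sub>R h"
    have "c = (1 / t) *\<^sub>R (t *\<^sub>R 1 - h)" using False by (simp add: c_def algebra_simps)
    then have "norm c \<le> 1" using t False by simp
    moreover have "star c = c" by (simp add: c_def star_scaleR star_diff sa)
    ultimately obtain b where b: "star b = b" "b * b = 1 - c" "norm (1 - b) \<le> 1"
      "\<And>d. d * c = c * d \<Longrightarrow> d * b = b * d"
      using sqrt_one_minus by metis
    show thesis
    proof (rule that[of "sqrt t *\<^sub>R b"])
      show "sqrt t *\<^sub>R b \<in> pos_cone"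
        using b(1,3) t by (intro pos_cone_scaleR pos_coneI[where t=1]) auto
      show "(sqrt t *\<^sub>R b) * (sqrt t *\<^sub>R b) = h" using b(2) t False by (simp add: c_def)
      show "d * (sqrt t *\<^sub>R b) = (sqrt t *\<^sub>R b) * d" if "d * h = h * d" for d
        using b(4)[of d] that by (simp add: c_def algebra_simps)
    qed
  qed
qed

text \<open>The element \<open>b + \<i>s\<close> is a multiple of a unitary.\<close>

lemma norm_square_le_of_sum_squares:
  fixes b s :: "'a::unital_cstar_algebra"
  assumes "star b = b" "star s = s" "b * s = s * b" "b * b + s * s = r *\<^sub>R 1" "r \<ge> 0"
  shows "norm (s * s) \<le> r"
proof -
  define u where "u = b + \<i> *\<^sub>C s"
  have su: "star u = b - \<i> *\<^sub>C s"
    using assms by (simp add: u_def star_add star_scaleC)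
  have "star u * u = b * b + s * s"
    using assms(3) unfolding su
    by (simp add: u_def algebra_simps scaleC_mult_left scaleC_mult_right scaleC_scaleC scaleC_diff_right)
  then have nu: "norm u = sqrt r"
    using cstar_identity[of u] assms by (simp add: real_sqrt_unique)
  have "u - star u = \<i> *\<^sub>C s + \<i> *\<^sub>C s"
    unfolding su by (simp add: u_def)
  also have "\<dots> = (2 * \<i>) *\<^sub>C s" by (simp only: mult_2 scaleC_add_left)
  finally have "2 * norm s = norm (u - star u)"
    by (simp add: norm_scaleC norm_mult)
  also have "\<dots> \<le> 2 * sqrt r" using norm_triangle_ineq4[of u "star u"] nu by simp
  finally have "norm s \<le> sqrt r" by simp
  then have "(norm s)\<^sup>2 \<le> r" using assms(5) by (metis norm_ge_zero power_mono real_sqrt_pow2)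
  then show ?thesis using norm_selfadjoint_square assms(2) by metis
qed

text \<open>At norm 1 let \<open>s\<close> be a root of \<open>1 - k * k\<close>. Then
  \<open>k * k + s * s = 1\<close>, and the preceding bound gives
  \<open>norm (1 - k * k) \<le> 1\<close>, which is membership with radius 1.\<close>

lemma square_in_pos_cone:
  fixes h :: "'a::unital_cstar_algebra"
  assumes "star h = h"
  shows "h * h \<in> pos_cone"
proof (cases "h = 0")
  case False
  define k where "k = (1 / norm h) *\<^sub>R h"
  have k: "star k = k" "norm k = 1" using assms False by (simp_all add: k_def star_scaleR)
  then have kk: "star (k * k) = k * k" "norm (k * k) \<le> 1"
    by (simp_all add: star_mult norm_selfadjoint_square)
  obtain s where s: "star s = s" "s * s = 1 - k * k"
    "\<And>d. d * (k * k) = (k * k) * d \<Longrightarrow> d * s = s * d"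
    using sqrt_one_minus[OF kk] by metis
  have "norm (s * s) \<le> 1"
    using s k by (intro norm_square_le_of_sum_squares[where b=k]) (auto simp: mult.assoc)
  then have "k * k \<in> pos_cone"
    using kk by (intro pos_coneI[where t=1]) (simp_all add: s(2)[symmetric])
  then have "(norm h)\<^sup>2 *\<^sub>R (k * k) \<in> pos_cone" by (rule pos_cone_scaleR) simp
  moreover have "(norm h)\<^sup>2 *\<^sub>R (k * k) = h * h"
    using False by (simp add: k_def power2_eq_square)
  ultimately show ?thesis by simp
qed auto

text \<open>The roots of \<open>x\<close> and of \<open>r *\<^sub>R 1 - x\<close> commute, and their
  squares add up to \<open>r *\<^sub>R 1\<close>.\<close>

lemma norm_le_of_pos_cone_diff:
  fixes x :: "'a::unital_cstar_algebra"
  assumes "x \<in> pos_cone" "r *\<^sub>R 1 - x \<in> pos_cone" "r \<ge> 0"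
  shows "norm x \<le> r"
proof -
  obtain b where b: "b \<in> pos_cone" "b * b = r *\<^sub>R 1 - x"
    "\<And>d. d * (r *\<^sub>R 1 - x) = (r *\<^sub>R 1 - x) * d \<Longrightarrow> d * b = b * d"
    using pos_cone_sqrt[OF assms(2)] by metis
  obtain s where s: "s \<in> pos_cone" "s * s = x" "\<And>d. d * x = x * d \<Longrightarrow> d * s = s * d"
    using pos_cone_sqrt[OF assms(1)] by metis
  have "x * b = b * x" using b(3)[of x] by (simp add: algebra_simps)
  then have "b * s = s * b" using s(3)[of b] by simp
  then show ?thesis
    using norm_square_le_of_sum_squares[of b s r] b(1,2) s(1,2) assms(3) by (simp add: pos_cone_selfadjoint)
qed

lemma norm_mono_pos_cone:
  fixes x y :: "'a::unital_cstar_algebra"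
  assumes "x \<in> pos_cone" "y \<in> pos_cone"
  shows "norm x \<le> norm (x + y)"
proof (rule norm_le_of_pos_cone_diff[OF assms(1)])
  have "norm (x + y) *\<^sub>R 1 - (x + y) \<in> pos_cone"
    using assms by (intro pos_cone_diff) (simp_all add: star_add pos_cone_selfadjoint)
  from pos_cone_add[OF this assms(2)]
  show "norm (x + y) *\<^sub>R 1 - x \<in> pos_cone" by simp
qed simp

lemma pos_cone_antisym:
  fixes x :: "'a::unital_cstar_algebra"
  assumes "x \<in> pos_cone" "- x \<in> pos_cone"
  shows "x = 0"
  using norm_mono_pos_cone[OF assms] by simp

text \<open>Since \<open>(1 + x) * (1 + x)\<close> exceeds \<open>4 *\<^sub>R x\<close> by the
  square of \<open>1 - x\<close>, its norm is at least 4. The value 2 will force a functional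
  norming \<open>1 + x\<close> to norm 1 and \<open>x\<close> simultaneously.\<close>

lemma norm_one_plus_pos_cone:
  fixes x :: "'a::unital_cstar_algebra"
  assumes x: "x \<in> pos_cone" "norm x = 1"
  shows "norm (1 + x) = 2"
proof -
  have sa: "star x = x" using x by (simp add: pos_cone_selfadjoint)
  have "norm (4 *\<^sub>R x) \<le> norm (4 *\<^sub>R x + (1 - x) * (1 - x))"
    using x sa by (metis norm_mono_pos_cone pos_cone_scaleR square_in_pos_cone star_diff star_one zero_le_numeral)
  also have "4 *\<^sub>R x + (1 - x) * (1 - x) = (1 + x) * (1 + x)"
  proof -
    have "4 *\<^sub>R x = 2 *\<^sub>R (2 *\<^sub>R x)" by simp
    then have "4 *\<^sub>R x = (x + x) + (x + x)" unfolding scaleR_2 .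
    moreover have "(1 + x) * (1 + x) = (x + x) + (x + x) + (1 - x) * (1 - x)"
      by (simp add: algebra_simps)
    ultimately show ?thesis by simp
  qed
  also have "norm \<dots> = (norm (1 + x))\<^sup>2" using sa by (intro norm_selfadjoint_square) (simp add: star_add)
  finally have "2\<^sup>2 \<le> (norm (1 + x))\<^sup>2" using x by simp
  then have "2 \<le> norm (1 + x)" by (rule power2_le_imp_le) simp
  then show ?thesis using norm_triangle_ineq[of 1 x] x by simp
qed

section \<open>Spectral positivity, and positivity of \<open>star x * x\<close>\<close>

lemma spectrum_iff: "c \<in> spectrum x \<longleftrightarrow> \<not> invertible_elem (c *\<^sub>C 1 - x)"
  by (simp add: spectrum_def invertible_elem_def)

text \<open>With \<open>t = norm a\<close>, a norm \<open>r > t\<close> of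
  \<open>t *\<^sub>R 1 - a\<close> would produce a spectral value of \<open>a\<close> at distance at
  least \<open>r\<close> from \<open>t\<close>, while all of them lie between 0 and
  \<open>t\<close>.\<close>

lemma positive_element_in_pos_cone:
  fixes a :: "'a::unital_cstar_algebra"
  assumes "positive_element a"
  shows "a \<in> pos_cone"
proof -
  have sa: "star a = a" and sp: "spectrum a \<subseteq> \<real>\<^sub>\<ge>\<^sub>0"
    using assms by (auto simp: positive_element_def)
  define t where "t = norm a"
  have "norm (t *\<^sub>R 1 - a) \<le> t"
  proof (rule ccontr)
    assume nle: "\<not> norm (t *\<^sub>R 1 - a) \<le> t"
    define r where "r = norm (t *\<^sub>R 1 - a)"
    have r: "r > t" "t \<ge> 0" "r > 0"
      using nle norm_ge_zero[of a] unfolding r_def t_def by linarith+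
    define c where "c = (1 / r) *\<^sub>R (t *\<^sub>R 1 - a)"
    have "star c = c" "norm c = 1"
      using r sa by (simp_all add: c_def star_scaleR star_diff flip: r_def)
    then obtain z where z: "cmod z \<le> 1" "\<not> invertible_elem (1 - z *\<^sub>C c)"
      using selfadjoint_norm_one_spectrum by blast
    have z0: "z \<noteq> 0" using z by (auto simp: invertible_elem_def)
    \<comment> \<open>The spectral value of \<open>a\<close> that corresponds to the value
      \<open>1 / z\<close> of \<open>c\<close>, as
      \<open>a = t *\<^sub>R 1 - r *\<^sub>R c\<close>.\<close>
    define l where "l = of_real t - of_real r / z"
    have "(- (z / of_real r)) *\<^sub>C (l *\<^sub>C 1 - a) = 1 - z *\<^sub>C c"
    proof -
      have "z *\<^sub>C c = (z / of_real r * of_real t) *\<^sub>C 1 - (z / of_real r) *\<^sub>C a"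
        using scaleC_of_real[of "1 / r" "t *\<^sub>R 1 - a", symmetric] scaleC_of_real[of t "1 :: 'a", symmetric]
        by (simp add: c_def scaleC_diff_right scaleC_scaleC)
      moreover have "(z / of_real r * l) = z / of_real r * of_real t - 1"
        using z0 r by (simp add: l_def field_simps)
      ultimately show ?thesis by (simp add: scaleC_diff_right scaleC_scaleC scaleC_diff_left)
    qed
    then have ni: "\<not> invertible_elem (l *\<^sub>C 1 - a)"
      using invertible_elem_scaleC[of "l *\<^sub>C 1 - a" "- (z / of_real r)"] z z0 r by auto
    then have "l \<in> \<real>\<^sub>\<ge>\<^sub>0" using sp by (auto simp: spectrum_iff)
    then obtain s where s: "l = of_real s" "s \<ge> 0" by (auto simp: nonneg_Reals_def)
    have "cmod l \<le> t" using ni invertible_elem_scaleC_one_minus[of a l] unfolding t_def by (meson not_le)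
    then have "s \<le> t" using s by simp
    have "of_real r / z = of_real (t - s)" using s by (simp add: l_def algebra_simps)
    then have "cmod (of_real r / z) = t - s" using \<open>s \<le> t\<close> by (metis abs_of_nonneg diff_ge_0_iff_ge norm_of_real)
    moreover have "cmod (of_real r / z) \<ge> r"
      using z z0 r by (simp add: norm_divide le_divide_eq mult_left_le)
    ultimately show False using r s by simp
  qed
  then show ?thesis using sa by (rule pos_coneI[rotated])
qed

lemma invertible_elem_pos_cone_add:
  fixes m :: "'a::unital_cstar_algebra"
  assumes "m \<in> pos_cone" "t > 0"
  shows "invertible_elem (t *\<^sub>R 1 + m)"
proof -
  obtain s where s: "s \<ge> 0" "norm (s *\<^sub>R 1 - m) \<le> s"
    using assms by (auto simp: pos_cone_def)
  have "invertible_elem (of_real (s + t) *\<^sub>C 1 - (s *\<^sub>R 1 - m))"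
    by (rule invertible_elem_scaleC_one_minus, unfold norm_of_real) (use s assms in linarith)
  moreover have "of_real (s + t) *\<^sub>C 1 - (s *\<^sub>R 1 - m) = t *\<^sub>R 1 + m"
    unfolding scaleC_of_real by (simp add: algebra_simps)
  ultimately show ?thesis by (simp only:)
qed

text \<open>Multiplying by the conjugate factor gives
  \<open>(Im c)\<^sup>2 *\<^sub>R 1 + k * k\<close>, a positive scalar plus a square, which is
  invertible; hence so is each of the two commuting factors.\<close>

lemma invertible_elem_selfadjoint_nonreal:
  fixes h :: "'a::unital_cstar_algebra"
  assumes "star h = h" "Im c \<noteq> 0"
  shows "invertible_elem (c *\<^sub>C 1 - h)"
proof -
  define k where "k = Re c *\<^sub>R 1 - h"
  have k: "star k = k" by (simp add: k_def assms star_diff star_scaleR)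
  have c: "c *\<^sub>C 1 - h = k + (\<i> * of_real (Im c)) *\<^sub>C 1"
    by (subst complex_eq[of c]) (simp add: k_def scaleC_add_left scaleC_of_real)
  define j where "j = (\<i> * of_real (Im c)) *\<^sub>C (1::'a)"
  have jj: "j * j = - ((Im c)\<^sup>2 *\<^sub>R 1)"
  proof -
    have "j * j = of_real (- ((Im c)\<^sup>2)) *\<^sub>C 1"
      unfolding j_def scaleC_mult_both by (simp add: power2_eq_square mult_ac)
    then show ?thesis unfolding scaleC_of_real by simp
  qed
  have kj: "k * j = j * k" by (simp add: j_def scaleC_mult_left scaleC_mult_right)
  have "(k + j) * (k - j) = (Im c)\<^sup>2 *\<^sub>R 1 + k * k" "(k - j) * (k + j) = (Im c)\<^sup>2 *\<^sub>R 1 + k * k"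
    using jj kj by (simp_all add: algebra_simps)
  moreover have "invertible_elem ((Im c)\<^sup>2 *\<^sub>R 1 + k * k)"
    using assms by (intro invertible_elem_pos_cone_add square_in_pos_cone k) simp
  ultimately show ?thesis
    using invertible_elem_commuting_factor[of "k + j" "k - j"] c by (simp add: j_def)
qed

text \<open>The sum \<open>star y * y + y * star y\<close> lies in the cone, so the hypothesis puts
  \<open>y * star y\<close> there too. But \<open>star y * y\<close> and \<open>y * star y\<close>
  have the same nonzero spectrum, so \<open>- (y * star y)\<close> is positive as well, and
  antisymmetry applies.\<close>

lemma star_mult_self_not_negative:
  fixes y :: "'a::unital_cstar_algebra"
  assumes m: "- (star y * y) \<in> pos_cone"
  shows "y = 0"
proof -
  \<comment> \<open>Up to sign, twice the imaginary part of \<open>y\<close>; its square and that of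
    \<open>y + star y\<close> add up to
    \<open>2 *\<^sub>R (star y * y + y * star y)\<close>.\<close>
  define d where "d = \<i> *\<^sub>C (y - star y)"
  have "star d = d" by (simp add: d_def star_scaleC star_diff star_star scaleC_diff_right)
  then have "(y + star y) * (y + star y) + d * d \<in> pos_cone"
    by (intro pos_cone_add square_in_pos_cone) (simp_all add: star_add star_star add.commute)
  moreover have "(y + star y) * (y + star y) + d * d = 2 *\<^sub>R (star y * y + y * star y)"
    unfolding scaleR_2 d_def scaleC_mult_both by (simp add: algebra_simps)
  ultimately have "(1/2) *\<^sub>R (2 *\<^sub>R (star y * y + y * star y)) \<in> pos_cone"
    by (metis pos_cone_scaleR zero_le_divide_1_iff zero_le_numeral)
  then have "star y * y + y * star y \<in> pos_cone" by simp
  from pos_cone_add[OF this m] have p: "y * star y \<in> pos_cone" by simp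
  have "positive_element (- (y * star y))"
    unfolding positive_element_def
  proof (intro conjI subsetI)
    show sa: "star (- (y * star y)) = - (y * star y)" by (simp add: star_minus star_mult star_star)
    fix c assume c: "c \<in> spectrum (- (y * star y))"
    then have "Im c = 0"
      using invertible_elem_selfadjoint_nonreal[OF sa] by (auto simp: spectrum_iff)
    then have cr: "c = of_real (Re c)" by (simp add: complex_eq_iff)
    have "Re c \<ge> 0"
    proof (rule ccontr)
      define t where "t = Re c"
      assume "\<not> Re c \<ge> 0"
      then have t: "t < 0" by (simp add: t_def)
      \<comment> \<open>A negative \<open>t\<close> is excluded on the side of
        \<open>star y * y\<close>, where the element is 1 plus a member of the cone; the swap
        carries this over to \<open>y * star y\<close>.\<close>
      have "invertible_elem (1 *\<^sub>R 1 + (- 1 / t) *\<^sub>R (- (star y * y)))"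
        using t by (intro invertible_elem_pos_cone_add pos_cone_scaleR m) auto
      then have "invertible_elem (1 - ((- 1 / t) *\<^sub>R star y) * y)" by simp
      then have "invertible_elem (1 - y * ((- 1 / t) *\<^sub>R star y))"
        by (rule invertible_elem_one_minus_swap)
      then have "invertible_elem (of_real t *\<^sub>C (1 - y * ((- 1 / t) *\<^sub>R star y)))"
        using t by (intro invertible_elem_scaleC) auto
      moreover have "of_real t *\<^sub>C (1 - y * ((- 1 / t) *\<^sub>R star y)) = c *\<^sub>C 1 - (- (y * star y))"
        using t by (subst cr, unfold scaleC_of_real) (simp add: t_def scaleR_add_right)
      ultimately show False using c by (simp add: spectrum_iff)
    qed
    then show "c \<in> \<real>\<^sub>\<ge>\<^sub>0" by (subst cr) simp
  qed
  then have "- (y * star y) \<in> pos_cone" by (rule positive_element_in_pos_cone)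
  with p have "y * star y = 0" by (rule pos_cone_antisym)
  then show "y = 0" using cstar_identity[of "star y"] by (simp add: star_star)
qed

text \<open>Fukamiya--Kaplansky: with \<open>h = x\<^sup>*x\<close>, \<open>n = \<bar>h\<bar> - h\<close> and \<open>y = xn\<close> one has
  \<open>y\<^sup>*y = nhn = - n\<bar>h\<bar>n\<close>, which is negative, hence zero.\<close>

theorem star_mult_self_in_pos_cone:
  fixes x :: "'a::unital_cstar_algebra"
  shows "star x * x \<in> pos_cone"
proof -
  define h where "h = star x * x"
  have sh: "star h = h" by (simp add: h_def star_mult star_star)
  obtain g where g: "g \<in> pos_cone" "g * g = h * h"
    and gc: "\<And>d. d * (h * h) = (h * h) * d \<Longrightarrow> d * g = g * d"
    using pos_cone_sqrt[OF square_in_pos_cone[OF sh]] by metis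
  have hg: "h * g = g * h" by (rule gc) (simp add: mult.assoc)
  have sg: "star g = g" by (rule pos_cone_selfadjoint) (rule g)
  define n where "n = g - h"
  have sn: "star n = n" by (simp add: n_def star_diff sh sg)
  \<comment> \<open>The root \<open>r\<close> of \<open>g\<close> commutes with \<open>n\<close>,
    which makes \<open>n * (g * n)\<close> the square of the self-adjoint element
    \<open>r * n\<close>.\<close>
  obtain r where r: "r \<in> pos_cone" "r * r = g"
    and rc: "\<And>d. d * g = g * d \<Longrightarrow> d * r = r * d"
    using pos_cone_sqrt[OF g(1)] by metis
  have sr: "star r = r" by (rule pos_cone_selfadjoint) (rule r)
  have "n * g = g * n" by (simp add: n_def algebra_simps hg)
  then have nr: "n * r = r * n" by (rule rc)
  have hn: "h * n = - (g * n)" by (simp add: n_def algebra_simps hg g)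
  have sq: "(r * n) * (r * n) = n * (g * n)"
    by (metis mult.assoc nr r(2))
  have "star (x * n) * (x * n) = n * (h * n)"
    by (simp add: star_mult sn h_def mult.assoc)
  then have "- (star (x * n) * (x * n)) = (r * n) * (r * n)" by (simp add: hn sq)
  moreover have srn: "star (r * n) = r * n" by (simp add: star_mult sn sr nr)
  ultimately have "x * n = 0"
    using square_in_pos_cone[OF srn] by (intro star_mult_self_not_negative) simp
  then have "(r * n) * (r * n) = 0"
    using \<open>- (star (x * n) * (x * n)) = (r * n) * (r * n)\<close> by simp
  then have "r * n = 0" using norm_selfadjoint_square[OF srn] by simp
  then have "g * n = 0" by (metis mult.assoc mult_zero_right r(2))
  then have "n * n = 0" using hn by (simp add: n_def left_diff_distrib)
  then have "n = 0" using norm_selfadjoint_square[OF sn] by simp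
  then show ?thesis using g by (simp add: n_def h_def)
qed

subsection \<open>The Hahn-Banach theorem\<close>

definition sublinear :: "('a::real_vector \<Rightarrow> real) \<Rightarrow> bool" where
  "sublinear p \<longleftrightarrow> (\<forall>x y. p (x + y) \<le> p x + p y) \<and> (\<forall>x. \<forall>r\<ge>0. p (r *\<^sub>R x) = r * p x)"

lemma sublinearI:
  assumes "\<And>x y. p (x + y) \<le> p x + p y" "\<And>x r. r > 0 \<Longrightarrow> p (r *\<^sub>R x) \<le> r * p x" "p 0 = 0"
  shows "sublinear p"
  unfolding sublinear_def
proof (intro conjI allI impI)
  fix x :: 'a and r :: real assume "r \<ge> 0"
  show "p (r *\<^sub>R x) = r * p x"
  proof (cases "r = 0")
    case False
    then have r: "r > 0" using \<open>r \<ge> 0\<close> by simp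
    have "p ((1 / r) *\<^sub>R (r *\<^sub>R x)) \<le> (1 / r) * p (r *\<^sub>R x)" using r by (intro assms(2)) simp
    then have "r * p x \<le> p (r *\<^sub>R x)" using r by (simp add: field_simps)
    then show ?thesis using assms(2)[OF r, of x] by simp
  qed (simp add: assms(3))
qed (rule assms(1))

lemma sublinear_add: "sublinear p \<Longrightarrow> p (x + y) \<le> p x + p y"
  by (simp add: sublinear_def)

lemma sublinear_scaleR: "sublinear p \<Longrightarrow> r \<ge> 0 \<Longrightarrow> p (r *\<^sub>R x) = r * p x"
  by (simp add: sublinear_def)

lemma sublinear_zero: "sublinear p \<Longrightarrow> p 0 = 0"
  using sublinear_scaleR[of p 0 0] by simp

lemma sublinear_minus: "sublinear p \<Longrightarrow> - p (- x) \<le> p x"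
  using sublinear_add[of p x "- x"] sublinear_zero[of p] by simp

text \<open>Zorn's lemma with pointwise infima of chains. They are finite by
  \<open>- p (- x) \<le> q x\<close>, and subadditive because the smaller of two members of a chain
  serves for both arguments.\<close>

lemma sublinear_minimal_exists:
  fixes p :: "'a::real_vector \<Rightarrow> real"
  assumes p: "sublinear p"
  obtains q where "sublinear q" "\<And>x. q x \<le> p x"
    "\<And>q'. sublinear q' \<Longrightarrow> (\<And>x. q' x \<le> q x) \<Longrightarrow> q' = q"
proof -
  define A where "A = {q. sublinear q \<and> (\<forall>x. q x \<le> p x)}"
  define P where "P q q' \<longleftrightarrow> (\<forall>x. q' x \<le> q x)" for q q' :: "'a \<Rightarrow> real"
  have "\<exists>m\<in>A. \<forall>q\<in>A. P m q \<longrightarrow> q = m"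
  proof (rule predicate_Zorn)
    show "partial_order_on A (relation_of P A)"
      by (rule partial_order_on_relation_ofI)
         (auto simp: P_def fun_eq_iff intro: order.trans order.antisym)
  next
    fix C assume C: "C \<in> Chains (relation_of P A)"
    then have CA: "q \<in> A" if "q \<in> C" for q
      using that unfolding Chains_def relation_of_def by blast
    have lin: "P q q' \<or> P q' q" if "q \<in> C" "q' \<in> C" for q q'
      using that C unfolding Chains_def relation_of_def by blast
    show "\<exists>u\<in>A. \<forall>q\<in>C. P q u"
    proof (cases "C = {}")
      case True
      then show ?thesis using p by (intro bexI[of _ p]) (auto simp: A_def)
    next
      case False
      define u where "u x = (INF q\<in>C. q x)" for x
      have low: "- p (- x) \<le> q x" if "q \<in> C" for q x
        using CA[OF that] sublinear_minus[of q x] unfolding A_def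
        by (smt (verit) mem_Collect_eq)
      have bdd: "bdd_below ((\<lambda>q. q x) ` C)" for x
        by (rule bdd_belowI2) (rule low)
      have le: "u x \<le> q x" if "q \<in> C" for q x
        unfolding u_def by (rule cINF_lower[OF bdd that])
      have u_add: "u (x + y) \<le> q x + q' y" if q: "q \<in> C" "q' \<in> C" for q q' x y
      proof -
        have "\<exists>r\<in>C. r x \<le> q x \<and> r y \<le> q' y" using lin[OF q] q by (auto simp: P_def)
        then obtain r where r: "r \<in> C" "r x \<le> q x" "r y \<le> q' y" by blast
        have "u (x + y) \<le> r (x + y)" using le r by blast
        also have "\<dots> \<le> r x + r y" using CA[OF r(1)] by (auto simp: A_def intro: sublinear_add)
        finally show ?thesis using r by simp
      qed
      have "sublinear u"
      proof (rule sublinearI)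
        fix x y
        have "u (x + y) - q x \<le> u y" if "q \<in> C" for q
          unfolding u_def[of y]
        proof (rule cINF_greatest[OF False])
          show "u (x + y) - q x \<le> q' y" if "q' \<in> C" for q'
            using u_add[OF \<open>q \<in> C\<close> that, of x y] by simp
        qed
        then have "u (x + y) - u y \<le> q x" if "q \<in> C" for q
          using that by (simp add: algebra_simps)
        then have "u (x + y) - u y \<le> u x"
          unfolding u_def[of x] by (rule cINF_greatest[OF False])
        then show "u (x + y) \<le> u x + u y" by simp
      next
        fix x and r :: real assume r: "r > 0"
        have "u (r *\<^sub>R x) / r \<le> q x" if "q \<in> C" for q
        proof -
          have "u (r *\<^sub>R x) \<le> q (r *\<^sub>R x)" by (rule le[OF that])
          also have "\<dots> = r * q x" using r CA[OF that] by (auto simp: A_def sublinear_scaleR)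
          finally show ?thesis using r by (simp add: field_simps)
        qed
        then have "u (r *\<^sub>R x) / r \<le> u x" unfolding u_def[of x] by (rule cINF_greatest[OF False])
        then show "u (r *\<^sub>R x) \<le> r * u x" using r by (simp add: field_simps)
      next
        have "(\<lambda>q. q 0) ` C = {0}" using False CA by (auto simp: A_def sublinear_zero image_iff)
        then show "u 0 = 0" by (simp add: u_def)
      qed
      moreover have "u x \<le> p x" for x
        using False CA le unfolding A_def by (metis (mono_tags, lifting) all_not_in_conv mem_Collect_eq order.trans)
      ultimately show ?thesis using le by (intro bexI[of _ u]) (auto simp: A_def P_def)
    qed
  qed
  then obtain m where m: "m \<in> A" "\<And>q. q \<in> A \<Longrightarrow> P m q \<Longrightarrow> q = m" by blast
  show thesis
  proof (rule that[of m])
    show "q' = m" if "sublinear q'" "\<And>x. q' x \<le> m x" for q'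
    proof (rule m(2))
      show "q' \<in> A" using that m(1) unfolding A_def by (auto intro: order.trans[OF that(2)])
      show "P m q'" using that by (simp add: P_def)
    qed
  qed (use m in \<open>auto simp: A_def\<close>)
qed

text \<open>The witness is the infimum over \<open>t \<ge> 0\<close> of
  \<open>q (x + t *\<^sub>R y) - t * q y\<close>; \<open>t = 0\<close> and \<open>t = 1\<close> give
  the two bounds. If \<open>q\<close> is minimal, then \<open>q' = q\<close>, and the second bound
  says that \<open>q\<close> is superadditive.\<close>

lemma sublinear_descent:
  fixes q :: "'a::real_vector \<Rightarrow> real"
  assumes q: "sublinear q"
  obtains q' where "sublinear q'" "\<And>x. q' x \<le> q x" "\<And>x. q' x \<le> q (x + y) - q y"
proof -
  define g where "g t x = q (x + t *\<^sub>R y) - t * q y" for t x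
  define q' where "q' x = (INF t\<in>{0..}. g t x)" for x
  have low: "- q (- x) \<le> g t x" if "t \<in> {0..}" for t x
    using sublinear_add[OF q, of "x + t *\<^sub>R y" "- x"] sublinear_scaleR[OF q, of t y] that
    by (simp add: g_def)
  have bdd: "bdd_below ((\<lambda>t. g t x) ` {0..})" for x
    by (rule bdd_belowI2) (rule low)
  have le: "q' x \<le> g t x" if "t \<ge> 0" for t x
    unfolding q'_def by (rule cINF_lower[OF bdd]) (use that in auto)
  have ne: "{0::real..} \<noteq> {}" by auto
  have q'_add: "q' (x + z) \<le> g s x + g t z" if "s \<ge> 0" "t \<ge> 0" for s t x z
  proof -
    have "q' (x + z) \<le> g (s + t) (x + z)" using that by (intro le) simp
    also have "\<dots> \<le> g s x + g t z"
      using sublinear_add[OF q, of "x + s *\<^sub>R y" "z + t *\<^sub>R y"]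
      by (simp add: g_def algebra_simps)
    finally show ?thesis .
  qed
  have "sublinear q'"
  proof (rule sublinearI)
    fix x z
    have "q' (x + z) - g s x \<le> q' z" if "s \<ge> 0" for s
      unfolding q'_def[of z]
    proof (rule cINF_greatest[OF ne])
      show "q' (x + z) - g s x \<le> g t z" if "t \<in> {0..}" for t
        using q'_add[of s t x z] \<open>s \<ge> 0\<close> that by simp
    qed
    then have "q' (x + z) - q' z \<le> g s x" if "s \<in> {0..}" for s
      using that by (simp add: algebra_simps)
    then have "q' (x + z) - q' z \<le> q' x"
      unfolding q'_def[of x] by (rule cINF_greatest[OF ne])
    then show "q' (x + z) \<le> q' x + q' z" by simp
  next
    fix x and r :: real assume r: "r > 0"
    have "q' (r *\<^sub>R x) / r \<le> g t x" if "t \<in> {0..}" for t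
    proof -
      have "q' (r *\<^sub>R x) \<le> g (r * t) (r *\<^sub>R x)" using that r by (intro le) simp
      also have "\<dots> = r * g t x"
        using sublinear_scaleR[OF q, of r "x + t *\<^sub>R y"] r by (simp add: g_def algebra_simps)
      finally show ?thesis using r by (simp add: field_simps)
    qed
    then have "q' (r *\<^sub>R x) / r \<le> q' x" unfolding q'_def[of x] by (rule cINF_greatest[OF ne])
    then show "q' (r *\<^sub>R x) \<le> r * q' x" using r by (simp add: field_simps)
  next
    have "g t 0 = 0" if "t \<in> {0..}" for t
      using that sublinear_scaleR[OF q, of t y] by (simp add: g_def)
    then have "(\<lambda>t. g t 0) ` {0..} = {0}" by (auto simp: image_iff)
    then show "q' 0 = 0" by (simp add: q'_def)
  qed
  moreover have "q' x \<le> q x" for x using le[of 0 x] by (simp add: g_def)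
  moreover have "q' x \<le> q (x + y) - q y" for x using le[of 1 x] by (simp add: g_def)
  ultimately show thesis using that by blast
qed

theorem Hahn_Banach_sublinear:
  fixes p :: "'a::real_vector \<Rightarrow> real"
  assumes p: "sublinear p"
  obtains f where "linear f" "\<And>x. f x \<le> p x" "f v = p v"
proof -
  \<comment> \<open>Descending along \<open>v\<close> gives \<open>p' (- v) \<le> - p v\<close>, so
    every linear functional below \<open>p'\<close> takes the value \<open>p v\<close> at
    \<open>v\<close>.\<close>
  obtain p' where p': "sublinear p'" "\<And>x. p' x \<le> p x" "\<And>x. p' x \<le> p (x + v) - p v"
    using sublinear_descent[OF p, of v] by blast
  obtain f where f: "sublinear f" "\<And>x. f x \<le> p' x"
    and min: "\<And>q. sublinear q \<Longrightarrow> (\<And>x. q x \<le> f x) \<Longrightarrow> q = f"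
    using sublinear_minimal_exists[OF p'(1)] by blast
  have "f x + f y \<le> f (x + y)" for x y
  proof -
    obtain q where q: "sublinear q" "\<And>x. q x \<le> f x" "\<And>x. q x \<le> f (x + y) - f y"
      using sublinear_descent[OF f(1), of y] by blast
    have "q = f" using min q by blast
    then show ?thesis using q(3)[of x] by simp
  qed
  then have add: "f (x + y) = f x + f y" for x y
    using sublinear_add[OF f(1)] by (intro order.antisym)
  then have neg: "f (- x) = - f x" for x
    using add[of x "- x"] sublinear_zero[OF f(1)] by simp
  have "f (r *\<^sub>R x) = r * f x" for r x
  proof (cases "r \<ge> 0")
    case False
    then show ?thesis using neg[of "(- r) *\<^sub>R x"] sublinear_scaleR[OF f(1), of "- r" x] by simp
  qed (simp add: sublinear_scaleR[OF f(1)])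
  then have "linear f" using add by (intro linearI) simp_all
  moreover have fp: "f x \<le> p x" for x using f p' order.trans by blast
  moreover have "f v = p v"
  proof (rule order.antisym)
    have "f (- v) \<le> p (- v + v) - p v" using f p' order.trans by blast
    then show "p v \<le> f v" using neg sublinear_zero[OF p] by simp
  qed (rule fp)
  ultimately show thesis using that by blast
qed

subsection \<open>Existence of states\<close>

theorem a_states_nonempty:
  fixes a :: "'a::unital_cstar_algebra"
  assumes "positive_element a" "a \<noteq> 0"
  shows "a_states a \<noteq> {}"
proof -
  define e where "e = (1 / norm a) *\<^sub>R a"
  have e: "e \<in> pos_cone" "norm e = 1"
    using assms by (simp_all add: e_def pos_cone_scaleR positive_element_in_pos_cone)
  have "sublinear (norm :: 'a \<Rightarrow> real)"
    by (rule sublinearI) (simp_all add: norm_triangle_ineq)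
  then obtain f where f: "linear f" "\<And>x. f x \<le> norm x" "f (1 + e) = norm (1 + e)"
    using Hahn_Banach_sublinear by blast
  \<comment> \<open>Both values are at most 1, so both equal 1. The first makes \<open>f\<close>
    nonnegative on the cone; the second keeps \<open>f a\<close> away from 0.\<close>
  have "f 1 + f e = 2" using f(3) norm_one_plus_pos_cone[OF e] linear_add[OF f(1)] by simp
  then have f1: "f 1 = 1" "f e = 1" using f(2)[of 1] f(2)[of e] e by simp_all
  have fpos: "f h \<ge> 0" if "h \<in> pos_cone" for h
  proof -
    obtain t where t: "norm (t *\<^sub>R 1 - h) \<le> t" using \<open>h \<in> pos_cone\<close> by (auto simp: pos_cone_def)
    have "f (t *\<^sub>R 1 - h) = t - f h" using f1 by (simp add: linear_diff[OF f(1)] linear_scale[OF f(1)])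
    then show ?thesis using f(2)[of "t *\<^sub>R 1 - h"] t by simp
  qed
  have fb: "\<bar>f x\<bar> \<le> norm x" for x using f(2)[of x] f(2)[of "- x"] by (simp add: linear_neg[OF f(1)])
  \<comment> \<open>\<open>f\<close> is real-linear and uncontrolled on skew-adjoint elements;
    averaging with \<open>star\<close> makes it vanish there, so that the complexification
    \<open>F\<close> still agrees with \<open>f\<close> on self-adjoint elements.\<close>
  define g where "g x = f ((1 / 2) *\<^sub>R (x + star x))" for x
  have g_add: "g (x + y) = g x + g y" for x y
  proof -
    have "(1 / 2) *\<^sub>R (x + y + star (x + y)) = (1 / 2) *\<^sub>R (x + star x) + (1 / 2) *\<^sub>R (y + star y)"
      by (simp add: star_add algebra_simps)
    then show ?thesis unfolding g_def by (simp only: linear_add[OF f(1)])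
  qed
  have g_scale: "g (r *\<^sub>R x) = r * g x" for r x
    unfolding g_def by (simp add: star_scaleR linear_scale[OF f(1)] linear_add[OF f(1)] algebra_simps)
  have g_sa: "g h = f h" if "star h = h" for h
    unfolding g_def that by (simp add: linear_scale[OF f(1)] linear_add[OF f(1)])
  have g_skew: "g (\<i> *\<^sub>C h) = 0" if "star h = h" for h
    unfolding g_def by (simp add: star_scaleC that linear_0[OF f(1)])
  have gb: "\<bar>g x\<bar> \<le> norm x" for x
  proof -
    have "\<bar>g x\<bar> \<le> norm ((1 / 2) *\<^sub>R (x + star x))" unfolding g_def by (rule fb)
    also have "\<dots> \<le> norm x" using norm_triangle_ineq[of x "star x"] by simp
    finally show ?thesis .
  qed
  define F where "F x = Complex (g x) (- g (\<i> *\<^sub>C x))" for x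
  have F_add: "F (x + y) = F x + F y" for x y
    by (simp add: F_def scaleC_add_right g_add complex_eq_iff)
  have F_scale: "F (c *\<^sub>C x) = c * F x" for c x
  proof -
    define y where "y = \<i> *\<^sub>C x"
    have "c *\<^sub>C x = (of_real (Re c) + of_real (Im c) * \<i>) *\<^sub>C x"
      by (metis complex_eq mult.commute)
    then have 1: "c *\<^sub>C x = Re c *\<^sub>R x + Im c *\<^sub>R y"
      unfolding scaleC_add_left scaleC_scaleC[symmetric] scaleC_of_real y_def .
    have "\<i> *\<^sub>C y = - x" by (simp add: y_def scaleC_scaleC)
    then have 2: "\<i> *\<^sub>C (c *\<^sub>C x) = Re c *\<^sub>R y + Im c *\<^sub>R (- x)"
      unfolding 1 scaleC_add_right scaleC_scaleR by (simp add: y_def)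
    have gm: "g (- x) = - g x" using g_scale[of "-1" x] by simp
    show ?thesis
      unfolding F_def 2 unfolding 1 y_def[symmetric] g_add g_scale gm by (simp add: complex_eq_iff)
  qed
  define \<phi> where "\<phi> x = of_real (1 / norm a) * F x" for x
  have "\<phi> \<in> dual_space"
    unfolding dual_space_def
  proof (intro CollectI conjI allI)
    show "bounded_linear \<phi>"
    proof (rule bounded_linear_intro[where K = "1 / norm a * 2"])
      show "\<phi> (x + y) = \<phi> x + \<phi> y" for x y by (simp add: \<phi>_def F_add add_divide_distrib)
      show "\<phi> (r *\<^sub>R x) = r *\<^sub>R \<phi> x" for r x
        using F_scale[of "of_real r" x]
        by (simp add: \<phi>_def scaleC_of_real scaleR_conv_of_real[where 'a=complex])
      fix x
      have "cmod (F x) \<le> \<bar>g x\<bar> + \<bar>g (\<i> *\<^sub>C x)\<bar>" unfolding F_def using cmod_le[of "Complex (g x) (- g (\<i> *\<^sub>C x))"] by simp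
      also have "\<dots> \<le> norm x * 2" using gb[of x] gb[of "\<i> *\<^sub>C x"] by (simp add: norm_scaleC)
      finally have "1 / norm a * cmod (F x) \<le> 1 / norm a * (norm x * 2)" by (intro mult_left_mono) auto
      then show "norm (\<phi> x) \<le> norm x * (1 / norm a * 2)" by (simp add: \<phi>_def norm_mult norm_divide mult_ac)
    qed
    show "\<phi> (c *\<^sub>C x) = c * \<phi> x" for c x by (simp add: \<phi>_def F_scale)
  qed
  moreover have F_sa: "F h = of_real (f h)" if "star h = h" for h
    using that by (simp add: F_def g_sa g_skew complex_eq_iff)
  have "positive_functional \<phi>"
    unfolding positive_functional_def
  proof
    fix x :: 'a
    have "f (star x * x) \<ge> 0" by (rule fpos[OF star_mult_self_in_pos_cone])
    then have "of_real (1 / norm a * f (star x * x)) \<in> \<real>\<^sub>\<ge>\<^sub>0" by (simp only: nonneg_Reals_of_real_iff) simp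
    moreover have "\<phi> (star x * x) = of_real (1 / norm a * f (star x * x))"
      by (simp add: \<phi>_def F_sa star_mult star_star)
    ultimately show "\<phi> (star x * x) \<in> \<real>\<^sub>\<ge>\<^sub>0" by (simp only:)
  qed
  moreover have "\<phi> a = 1"
  proof -
    have "a = norm a *\<^sub>R e" using assms by (simp add: e_def)
    then have "f a = norm a" using f1 linear_scale[OF f(1), of "norm a" e] by simp
    then show ?thesis using assms by (simp add: \<phi>_def F_sa positive_element_def)
  qed
  ultimately show ?thesis unfolding a_states_def by blast
qed

subsection \<open>Positive functionals\<close>

lemma dual_space_linear: "\<phi> \<in> dual_space \<Longrightarrow> linear \<phi>"
  by (auto simp: dual_space_def bounded_linear.linear)

lemma dual_space_scaleC: "\<phi> \<in> dual_space \<Longrightarrow> \<phi> (c *\<^sub>C x) = c * \<phi> x"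
  by (auto simp: dual_space_def)

text \<open>Positivity makes \<open>\<phi> (star u * u)\<close> real; taking
  \<open>u = 1 + x\<close> compares the imaginary parts, and \<open>u = 1 + \<i> *\<^sub>C x\<close>
  the real parts.\<close>

lemma positive_functional_star:
  fixes \<phi> :: "'a::unital_cstar_algebra \<Rightarrow> complex"
  assumes \<phi>: "\<phi> \<in> dual_space" "positive_functional \<phi>"
  shows "\<phi> (star x) = cnj (\<phi> x)"
proof -
  note add = linear_add[OF dual_space_linear[OF \<phi>(1)]]
  have real: "Im (\<phi> (star u * u)) = 0" for u
    using \<phi>(2) by (auto simp: positive_functional_def complex_nonneg_Reals_iff)
  have "\<phi> (star (1 + x) * (1 + x)) = \<phi> (star 1 * 1) + \<phi> x + \<phi> (star x) + \<phi> (star x * x)"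
    by (simp add: star_add algebra_simps add)
  then have 1: "Im (\<phi> x) + Im (\<phi> (star x)) = 0"
    using real[of "1 + x"] real[of 1] real[of x] by simp
  have "star (1 + \<i> *\<^sub>C x) * (1 + \<i> *\<^sub>C x) = star 1 * 1 + \<i> *\<^sub>C x + (- \<i>) *\<^sub>C star x + star x * x"
    by (simp add: star_add star_scaleC algebra_simps scaleC_mult_left scaleC_mult_right scaleC_scaleC
        scaleC_add_right scaleC_diff_right)
  then have "\<phi> (star (1 + \<i> *\<^sub>C x) * (1 + \<i> *\<^sub>C x))
      = \<phi> (star 1 * 1) + \<i> * \<phi> x + (- \<i>) * \<phi> (star x) + \<phi> (star x * x)"
    by (simp only: add dual_space_scaleC[OF \<phi>(1)])
  then have "Re (\<phi> x) - Re (\<phi> (star x)) = 0"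
    using real[of "1 + \<i> *\<^sub>C x"] real[of 1] real[of x] by simp
  with 1 show ?thesis by (simp add: complex_eq_iff)
qed

lemma positive_functional_form:
  fixes \<phi> :: "'a::unital_cstar_algebra \<Rightarrow> complex"
  assumes "positive_functional \<phi>" "a \<in> pos_cone"
  shows "\<phi> (star u * a * u) \<in> \<real>\<^sub>\<ge>\<^sub>0"
proof -
  obtain b where b: "b \<in> pos_cone" "b * b = a" using pos_cone_sqrt[OF assms(2)] by metis
  have "star u * a * u = star (b * u) * (b * u)"
    using b by (simp add: star_mult pos_cone_selfadjoint mult.assoc flip: b(2))
  then show ?thesis using assms(1) by (simp add: positive_functional_def)
qed

text \<open>At \<open>t = - s z\<close> with real \<open>s\<close> the hypothesis is a real
  quadratic inequality in \<open>s\<close>, sharpest at \<open>s = 1 / B\<close>. If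
  \<open>B\<close> were 0 with \<open>z \<noteq> 0\<close>, it would be linear in \<open>s\<close>
  and fail for large \<open>s\<close>.\<close>

lemma discriminant_bound:
  fixes z :: complex
  assumes *: "\<And>t. 0 \<le> A + 2 * Re (cnj t * z) + (cmod t)\<^sup>2 * B" and B: "B \<ge> 0"
  shows "(cmod z)\<^sup>2 \<le> A * B"
proof (cases "z = 0")
  case True
  then show ?thesis using *[of 0] B by simp
next
  case False
  have real: "2 * s * (cmod z)\<^sup>2 \<le> A + s\<^sup>2 * (cmod z)\<^sup>2 * B" for s
  proof -
    have "Re (cnj (- (of_real s * z)) * z) = - (s * (cmod z)\<^sup>2)"
      unfolding cmod_power2 by (simp add: power2_eq_square algebra_simps)
    moreover have "(cmod (- (of_real s * z)))\<^sup>2 = s\<^sup>2 * (cmod z)\<^sup>2"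
      by (simp add: norm_mult power_mult_distrib)
    ultimately show ?thesis using *[of "- (of_real s * z)"] by simp
  qed
  have "B \<noteq> 0"
  proof
    assume "B = 0"
    then show False using real[of "(A + 1) / (2 * (cmod z)\<^sup>2)"] False by simp
  qed
  then have B: "B > 0" using B by simp
  then show ?thesis using real[of "1 / B"] by (simp add: power2_eq_square field_simps)
qed

lemma weighted_Cauchy_Schwarz:
  fixes \<phi> :: "'a::unital_cstar_algebra \<Rightarrow> complex"
  assumes \<phi>: "\<phi> \<in> dual_space" "positive_functional \<phi>" and a: "a \<in> pos_cone"
    and p: "\<And>j. j \<in> J \<Longrightarrow> p j \<ge> (0::real)"
  shows "(cmod (\<Sum>j\<in>J. of_real (p j) * \<phi> (star (v j) * a * u j)))\<^sup>2
    \<le> (\<Sum>j\<in>J. p j * Re (\<phi> (star (u j) * a * u j))) * (\<Sum>j\<in>J. p j * Re (\<phi> (star (v j) * a * v j)))"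
proof (rule discriminant_bound)
  note add = linear_add[OF dual_space_linear[OF \<phi>(1)]]
  have nonneg: "Re (\<phi> (star w * a * w)) \<ge> 0" for w
    using positive_functional_form[OF \<phi>(2) a, of w] by (simp add: complex_nonneg_Reals_iff)
  then show "(\<Sum>j\<in>J. p j * Re (\<phi> (star (v j) * a * v j))) \<ge> 0"
    by (intro sum_nonneg mult_nonneg_nonneg p)
  fix t :: complex
  have expand: "Re (\<phi> (star (w + t *\<^sub>C w') * a * (w + t *\<^sub>C w')))
      = Re (\<phi> (star w * a * w)) + 2 * Re (cnj t * \<phi> (star w' * a * w))
        + (cmod t)\<^sup>2 * Re (\<phi> (star w' * a * w'))" for w w'
  proof -
    have "star (w + t *\<^sub>C w') * a * (w + t *\<^sub>C w')
       = star w * a * w + cnj t *\<^sub>C (star w' * a * w) + t *\<^sub>C (star w * a * w')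
         + (t * cnj t) *\<^sub>C (star w' * a * w')"
      by (simp add: star_add star_scaleC algebra_simps scaleC_mult_left scaleC_mult_right
          scaleC_scaleC scaleC_add_right)
    then have "\<phi> (star (w + t *\<^sub>C w') * a * (w + t *\<^sub>C w'))
       = \<phi> (star w * a * w) + cnj t * \<phi> (star w' * a * w) + t * \<phi> (star w * a * w')
         + (t * cnj t) * \<phi> (star w' * a * w')"
      by (simp only: add dual_space_scaleC[OF \<phi>(1)])
    moreover have "\<phi> (star w * a * w') = cnj (\<phi> (star w' * a * w))"
      using positive_functional_star[OF \<phi>, of "star w' * a * w"] a
      by (simp add: star_mult star_star pos_cone_selfadjoint mult.assoc)
    moreover have "t * cnj t = of_real ((cmod t)\<^sup>2)" by (metis complex_norm_square)
    ultimately show ?thesis by simp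
  qed
  have "0 \<le> (\<Sum>j\<in>J. p j * Re (\<phi> (star (u j + t *\<^sub>C v j) * a * (u j + t *\<^sub>C v j))))"
    by (intro sum_nonneg mult_nonneg_nonneg p nonneg)
  also have "\<dots> = (\<Sum>j\<in>J. p j * Re (\<phi> (star (u j) * a * u j)))
      + 2 * (\<Sum>j\<in>J. Re (cnj t * (of_real (p j) * \<phi> (star (v j) * a * u j))))
      + (cmod t)\<^sup>2 * (\<Sum>j\<in>J. p j * Re (\<phi> (star (v j) * a * v j)))"
    unfolding expand sum_distrib_left sum.distrib[symmetric]
    by (rule sum.cong) (simp_all add: algebra_simps)
  also have "(\<Sum>j\<in>J. Re (cnj t * (of_real (p j) * \<phi> (star (v j) * a * u j))))
      = Re (cnj t * (\<Sum>j\<in>J. of_real (p j) * \<phi> (star (v j) * a * u j)))"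
    by (simp add: sum_distrib_left del: complex_cnj_mult)
  finally show "0 \<le> (\<Sum>j\<in>J. p j * Re (\<phi> (star (u j) * a * u j)))
      + 2 * Re (cnj t * (\<Sum>j\<in>J. of_real (p j) * \<phi> (star (v j) * a * u j)))
      + (cmod t)\<^sup>2 * (\<Sum>j\<in>J. p j * Re (\<phi> (star (v j) * a * v j)))" .
qed

section \<open>Bounds for a-states\<close>

lemma a_state_square_bound:
  fixes a :: "'a::unital_cstar_algebra"
  assumes \<phi>: "\<phi> \<in> a_states a" and a: "a \<in> pos_cone"
  shows "(cmod (\<phi> (a * w)))\<^sup>2 \<le> Re (\<phi> (star w * a * w))"
  using weighted_Cauchy_Schwarz[of \<phi> a "{0::nat}" "\<lambda>_. 1" "\<lambda>_. 1" "\<lambda>_. w"] \<phi> a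
  by (simp add: a_states_def)

text \<open>Iterating \<open>\<bar>\<phi>(az)\<bar>\<^sup>2 \<le> \<phi>(az\<^sup>2)\<close> makes the constant in the boundedness of
  \<open>\<phi>\<close> irrelevant.\<close>

lemma a_state_bound:
  fixes a :: "'a::unital_cstar_algebra"
  assumes \<phi>: "\<phi> \<in> a_states a" and a: "a \<in> pos_cone" and z: "is_a_adjoint a z z"
  shows "cmod (\<phi> (a * z)) \<le> norm z"
proof (rule ccontr)
  assume "\<not> ?thesis"
  then have gt: "cmod (\<phi> (a * z)) > norm z" by simp
  have bl: "bounded_linear \<phi>" using \<phi> by (simp add: a_states_def dual_space_def)
  have z0: "norm z > 0" using gt linear_0[OF bounded_linear.linear[OF bl]] by auto
  \<comment> \<open>Powers of \<open>z\<close> remain self-adjoint for the form, so each squaring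
    step doubles the exponent of \<open>z\<close>.\<close>
  have pw: "star (z ^ m) * a = a * z ^ m" for m
  proof (induction m)
    case (Suc m)
    have "star (z ^ Suc m) * a = star (z ^ m) * (star z * a)"
      by (simp add: star_mult mult.assoc)
    also have "\<dots> = a * z ^ m * z" using z Suc by (simp add: is_a_adjoint_def mult.assoc[symmetric])
    finally show ?case by (simp add: mult.assoc power_commutes)
  qed simp
  have it: "cmod (\<phi> (a * z)) ^ (2 ^ n) \<le> cmod (\<phi> (a * z ^ (2 ^ n)))" for n
  proof (induction n)
    case (Suc n)
    have "cmod (\<phi> (a * z)) ^ (2 ^ Suc n) = (cmod (\<phi> (a * z)) ^ (2 ^ n))\<^sup>2"
      by (simp add: power2_eq_square power_add[symmetric] mult_2)
    also have "\<dots> \<le> (cmod (\<phi> (a * z ^ (2 ^ n))))\<^sup>2" using Suc by (intro power_mono) auto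
    also have "\<dots> \<le> Re (\<phi> (star (z ^ (2 ^ n)) * a * z ^ (2 ^ n)))"
      by (rule a_state_square_bound[OF \<phi> a])
    also have "star (z ^ (2 ^ n)) * a * z ^ (2 ^ n) = a * z ^ (2 ^ Suc n)"
      unfolding pw by (simp add: mult.assoc power_add[symmetric] mult_2)
    finally show ?case using complex_Re_le_cmod order.trans by blast
  qed simp
  obtain K where K: "K > 0" "\<And>w. cmod (\<phi> w) \<le> norm w * K"
    using bounded_linear.pos_bounded[OF bl] by blast
  define q where "q = cmod (\<phi> (a * z)) / norm z"
  have q: "q > 1" using gt z0 by (simp add: q_def)
  obtain n where n: "norm a * K < q ^ n" using real_arch_pow[OF q] by blast
  have "cmod (\<phi> (a * z)) ^ (2 ^ n) \<le> norm (a * z ^ (2 ^ n)) * K"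
    using it K order.trans by blast
  also have "\<dots> \<le> norm a * norm z ^ (2 ^ n) * K"
  proof (rule mult_right_mono)
    show "norm (a * z ^ (2 ^ n)) \<le> norm a * norm z ^ (2 ^ n)"
      by (meson mult_left_mono norm_ge_zero norm_mult_ineq norm_power_ineq order.trans)
  qed (use K in simp)
  finally have "q ^ (2 ^ n) \<le> norm a * K"
    using z0 by (simp add: q_def power_divide field_simps)
  moreover have "q ^ n \<le> q ^ (2 ^ n)" using q by (intro power_increasing) (auto simp: less_imp_le)
  ultimately show False using n by simp
qed

text \<open>The seminorm is a real supremum, so boundedness comes first:
  \<open>star z * a * z\<close> equals \<open>a * (z * z)\<close>, where the a-states are bounded by
  \<open>norm (z * z)\<close>.\<close>

lemma a_state_le_seminorm:
  fixes a :: "'a::unital_cstar_algebra"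
  assumes \<phi>: "\<phi> \<in> a_states a" and a: "a \<in> pos_cone" and z: "is_a_adjoint a z z"
  shows "cmod (\<phi> (a * z)) \<le> a_seminorm a z"
proof -
  have eq: "star z * a * z = a * (z * z)" using z by (simp add: is_a_adjoint_def mult.assoc)
  have zz: "is_a_adjoint a (z * z) (z * z)"
    using z by (simp add: is_a_adjoint_def star_mult) (metis mult.assoc)
  have "bdd_above ((\<lambda>\<psi>. sqrt (Re (\<psi> (star z * a * z)))) ` a_states a)"
  proof (rule bdd_aboveI2)
    fix \<psi> assume "\<psi> \<in> a_states a"
    then have "cmod (\<psi> (a * (z * z))) \<le> norm (z * z)" using a_state_bound a zz by blast
    then show "sqrt (Re (\<psi> (star z * a * z))) \<le> sqrt (norm (z * z))"
      unfolding eq using complex_Re_le_cmod order.trans by (intro real_sqrt_le_mono) blast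
  qed
  then have "sqrt (Re (\<phi> (star z * a * z))) \<le> a_seminorm a z"
    unfolding a_seminorm_def using \<phi> by (intro cSUP_upper)
  moreover have "cmod (\<phi> (a * z)) \<le> sqrt (Re (\<phi> (star z * a * z)))"
    using a_state_square_bound[OF \<phi> a, of z] by (intro real_le_rsqrt)
  ultimately show ?thesis by simp
qed

subsection \<open>The inequality\<close>

text \<open>Buzano's inequality in the \<open>p\<close>-weighted direct sum of the GNS spaces of \<open>\<phi>\<close>, with
  the vectors \<open>(x\<^sub>j)\<close>, \<open>(y\<^sub>j)\<close> and the unit vector \<open>(1)\<close>: the vector
  \<open>w\<close> below is the reflection of \<open>(x\<^sub>j)\<close> along \<open>(1)\<close>.\<close>

lemma a_state_Buzano:
  fixes a :: "'a::unital_cstar_algebra" and p :: "'i \<Rightarrow> real"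
  assumes \<phi>: "\<phi> \<in> a_states a" and a: "a \<in> pos_cone"
    and adj: "\<And>j. j \<in> J \<Longrightarrow> is_a_adjoint a (x j) (y j)"
    and p: "\<And>j. j \<in> J \<Longrightarrow> p j \<ge> 0" "(\<Sum>j\<in>J. p j) = 1"
  obtains P Q where "P \<ge> 0" "Q \<ge> 0"
    "P + Q \<le> (\<Sum>j\<in>J. p j * a_seminorm a (y j * x j + x j * y j))"
    "\<phi> (a * (\<Sum>j\<in>J. p j *\<^sub>R (y j * x j - x j * y j))) = of_real (P - Q)"
    "cmod (\<phi> (a * (\<Sum>j\<in>J. p j *\<^sub>R (x j)\<^sup>2))) \<le> sqrt (P * Q)"
    "2 * (cmod (\<phi> (a * (\<Sum>j\<in>J. p j *\<^sub>R x j))))\<^sup>2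
      \<le> sqrt (P * Q) + cmod (\<phi> (a * (\<Sum>j\<in>J. p j *\<^sub>R (x j)\<^sup>2)))"
proof -
  have \<phi>': "\<phi> \<in> dual_space" "positive_functional \<phi>" "\<phi> a = 1"
    using \<phi> by (auto simp: a_states_def)
  note lin = dual_space_linear[OF \<phi>'(1)]
  note add = linear_add[OF lin] and diff = linear_diff[OF lin] and sc = dual_space_scaleC[OF \<phi>'(1)]
  have lsum: "\<phi> (a * (\<Sum>j\<in>J. p j *\<^sub>R f j)) = (\<Sum>j\<in>J. of_real (p j) * \<phi> (a * f j))" for f
    by (simp add: sum_distrib_left linear_sum[OF lin] linear_scale[OF lin] scaleR_conv_of_real[where 'a=complex])
  have sa: "star a = a" using a by (rule pos_cone_selfadjoint)
  have adj1: "star (x j) * a = a * y j" if "j \<in> J" for j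
    using adj[OF that] by (simp add: is_a_adjoint_def)
  have adj2: "star (y j) * a = a * x j" if "j \<in> J" for j
    by (metis adj1[OF that] sa star_mult star_star)
  have Px: "star (x j) * a * x j = a * (y j * x j)" if "j \<in> J" for j
    using adj1[OF that] by (simp add: mult.assoc)
  have Qy: "star (y j) * a * y j = a * (x j * y j)" if "j \<in> J" for j
    using adj2[OF that] by (simp add: mult.assoc)
  define P where "P = (\<Sum>j\<in>J. p j * Re (\<phi> (star (x j) * a * x j)))"
  define Q where "Q = (\<Sum>j\<in>J. p j * Re (\<phi> (star (y j) * a * y j)))"
  have form: "Re (\<phi> (star w * a * w)) \<ge> 0" "\<phi> (star w * a * w) = of_real (Re (\<phi> (star w * a * w)))" for w
    using positive_functional_form[OF \<phi>'(2) a, of w]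
    by (auto simp: complex_nonneg_Reals_iff complex_eq_iff)
  have 1: "P \<ge> 0" "Q \<ge> 0" unfolding P_def Q_def by (intro sum_nonneg mult_nonneg_nonneg p form; simp)+
  have 2: "P + Q \<le> (\<Sum>j\<in>J. p j * a_seminorm a (y j * x j + x j * y j))"
    unfolding P_def Q_def sum.distrib[symmetric] distrib_left[symmetric]
  proof (intro sum_mono mult_left_mono p)
    fix j assume j: "j \<in> J"
    \<comment> \<open>Both \<open>y j * x j\<close> and \<open>x j * y j\<close> are their own
      a-adjoints, hence so is their sum, and the seminorm bound applies.\<close>
    define z where "z = y j * x j + x j * y j"
    have "star (x j) * star (y j) * a = a * (y j * x j)" "star (y j) * star (x j) * a = a * (x j * y j)"
      using adj1[OF j] adj2[OF j] by (metis mult.assoc)+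
    then have z: "is_a_adjoint a z z"
      by (simp add: is_a_adjoint_def z_def star_add star_mult distrib_left distrib_right)
    have "Re (\<phi> (star (x j) * a * x j)) + Re (\<phi> (star (y j) * a * y j)) = Re (\<phi> (a * z))"
      unfolding Px[OF j] Qy[OF j] by (simp add: z_def distrib_left add)
    also have "\<dots> \<le> a_seminorm a z"
      using a_state_le_seminorm[OF \<phi> a z] complex_Re_le_cmod order.trans by blast
    finally show "Re (\<phi> (star (x j) * a * x j)) + Re (\<phi> (star (y j) * a * y j))
        \<le> a_seminorm a (y j * x j + x j * y j)" by (simp add: z_def)
  qed auto
  have 3: "\<phi> (a * (\<Sum>j\<in>J. p j *\<^sub>R (y j * x j - x j * y j))) = of_real (P - Q)"
  proof -
    have "of_real (p j) * \<phi> (a * (y j * x j - x j * y j))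
        = of_real (p j * Re (\<phi> (star (x j) * a * x j)) - p j * Re (\<phi> (star (y j) * a * y j)))"
      if j: "j \<in> J" for j
    proof -
      have "\<phi> (a * (y j * x j - x j * y j)) = \<phi> (star (x j) * a * x j) - \<phi> (star (y j) * a * y j)"
        unfolding Px[OF j] Qy[OF j] by (simp add: right_diff_distrib diff)
      also have "\<dots> = of_real (Re (\<phi> (star (x j) * a * x j)) - Re (\<phi> (star (y j) * a * y j)))"
        by (subst form(2), subst (2) form(2)) simp
      finally show ?thesis by (simp add: right_diff_distrib)
    qed
    then show ?thesis
      unfolding lsum P_def Q_def sum_subtractf[symmetric] of_real_sum by (intro sum.cong) auto
  qed
  define \<beta> where "\<beta> = \<phi> (a * (\<Sum>j\<in>J. p j *\<^sub>R (x j)\<^sup>2))"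
  define \<alpha> where "\<alpha> = \<phi> (a * (\<Sum>j\<in>J. p j *\<^sub>R x j))"
  have \<alpha>: "\<alpha> = (\<Sum>j\<in>J. of_real (p j) * \<phi> (a * x j))" unfolding \<alpha>_def by (rule lsum)
  have \<beta>: "\<beta> = (\<Sum>j\<in>J. of_real (p j) * \<phi> (star (y j) * a * x j))"
    unfolding \<beta>_def lsum by (intro sum.cong) (simp_all add: adj2 mult.assoc power2_eq_square)
  have "(cmod \<beta>)\<^sup>2 \<le> P * Q"
    unfolding \<beta> P_def Q_def by (rule weighted_Cauchy_Schwarz[OF \<phi>'(1,2) a p(1)])
  then have 4: "cmod \<beta> \<le> sqrt (P * Q)" by (rule real_le_rsqrt)
  define w where "w j = (2 * \<alpha>) *\<^sub>C 1 - x j" for j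
  have ww: "Re (\<phi> (star (w j) * a * w j))
      = 4 * (cmod \<alpha>)\<^sup>2 - 4 * Re (cnj \<alpha> * \<phi> (a * x j)) + Re (\<phi> (star (x j) * a * x j))" for j
  proof -
    have "star (w j) * a * w j = (4 * (\<alpha> * cnj \<alpha>)) *\<^sub>C a - (2 * cnj \<alpha>) *\<^sub>C (a * x j)
        - (2 * \<alpha>) *\<^sub>C (star (x j) * a) + star (x j) * a * x j"
      by (simp add: w_def star_diff star_scaleC algebra_simps scaleC_mult_left scaleC_mult_right
          scaleC_scaleC scaleC_diff_right)
    then have "\<phi> (star (w j) * a * w j) = (4 * (\<alpha> * cnj \<alpha>)) * \<phi> a - (2 * cnj \<alpha>) * \<phi> (a * x j)
        - (2 * \<alpha>) * \<phi> (star (x j) * a) + \<phi> (star (x j) * a * x j)"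
      by (simp only: add diff sc)
    moreover have "\<phi> (star (x j) * a) = cnj (\<phi> (a * x j))"
      using positive_functional_star[OF \<phi>'(1,2), of "a * x j"] by (simp add: star_mult sa)
    moreover have "\<alpha> * cnj \<alpha> = of_real ((cmod \<alpha>)\<^sup>2)" by (metis complex_norm_square)
    ultimately have "\<phi> (star (w j) * a * w j) = of_real (4 * (cmod \<alpha>)\<^sup>2)
        - 2 * (cnj \<alpha> * \<phi> (a * x j)) - 2 * cnj (cnj \<alpha> * \<phi> (a * x j)) + \<phi> (star (x j) * a * x j)"
      using \<phi>'(3) by (simp add: mult.assoc)
    then show ?thesis by simp
  qed
  \<comment> \<open>The reflection preserves length because (1) is a unit vector: the weights sum to
    1 and \<open>\<phi> a = 1\<close>.\<close>
  have nw: "(\<Sum>j\<in>J. p j * Re (\<phi> (star (w j) * a * w j))) = P"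
  proof -
    have "(\<Sum>j\<in>J. p j * Re (\<phi> (star (w j) * a * w j)))
       = 4 * (cmod \<alpha>)\<^sup>2 * (\<Sum>j\<in>J. p j) - 4 * (\<Sum>j\<in>J. Re (cnj \<alpha> * (of_real (p j) * \<phi> (a * x j)))) + P"
      unfolding ww P_def sum_distrib_left sum.distrib[symmetric] sum_subtractf[symmetric]
      by (rule sum.cong) (simp_all add: algebra_simps)
    also have "(\<Sum>j\<in>J. Re (cnj \<alpha> * (of_real (p j) * \<phi> (a * x j)))) = Re (cnj \<alpha> * \<alpha>)"
      by (subst (2) \<alpha>) (simp add: sum_distrib_left)
    also have "Re (cnj \<alpha> * \<alpha>) = (cmod \<alpha>)\<^sup>2"
      unfolding cmod_power2 by (simp add: power2_eq_square)
    finally show ?thesis using p(2) by simp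
  qed
  \<comment> \<open>Since \<open>star (y j) * a = a * x j\<close>, pairing (1) with (y_j) gives
    \<alpha> once more; this is the source of the square.\<close>
  have "(\<Sum>j\<in>J. of_real (p j) * \<phi> (star (y j) * a * w j)) = 2 * \<alpha>\<^sup>2 - \<beta>"
  proof -
    have "\<phi> (star (y j) * a * w j) = (2 * \<alpha>) * \<phi> (a * x j) - \<phi> (star (y j) * a * x j)" if "j \<in> J" for j
      by (simp add: w_def right_diff_distrib scaleC_mult_right diff sc adj2[OF that])
    then have "(\<Sum>j\<in>J. of_real (p j) * \<phi> (star (y j) * a * w j))
        = (\<Sum>j\<in>J. (2 * \<alpha>) * (of_real (p j) * \<phi> (a * x j)) - of_real (p j) * \<phi> (star (y j) * a * x j))"
      by (intro sum.cong) (simp_all add: right_diff_distrib mult.left_commute)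
    also have "\<dots> = 2 * \<alpha> * \<alpha> - \<beta>"
      unfolding sum_subtractf sum_distrib_left[symmetric] \<beta> by (simp only: \<alpha>[symmetric])
    finally show ?thesis by (simp add: power2_eq_square)
  qed
  then have "(cmod (2 * \<alpha>\<^sup>2 - \<beta>))\<^sup>2 \<le> P * Q"
    using weighted_Cauchy_Schwarz[where v = y and u = w and p = p and J = J, OF \<phi>'(1,2) a p(1)] unfolding nw Q_def[symmetric] by simp
  then have "cmod (2 * \<alpha>\<^sup>2 - \<beta>) \<le> sqrt (P * Q)" by (rule real_le_rsqrt)
  moreover have "cmod (2 * \<alpha>\<^sup>2) \<le> cmod (2 * \<alpha>\<^sup>2 - \<beta>) + cmod \<beta>"
    using norm_triangle_ineq[of "2 * \<alpha>\<^sup>2 - \<beta>" \<beta>] by simp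
  ultimately have 5: "2 * (cmod \<alpha>)\<^sup>2 \<le> sqrt (P * Q) + cmod \<beta>" by (simp add: norm_mult norm_power)
  show thesis using that 1 2 3 4 5 unfolding \<alpha>_def \<beta>_def by blast
qed

text \<open>With \<open>w = sqrt (S\<^sup>2 - C\<^sup>2)\<close> the case \<open>\<mu> = 0\<close>
  reads \<open>\<alpha> ^ 4 \<le> w\<^sup>2 / 16 + 3 / 8 * (w * V)\<close>. The general case adds
  \<open>\<mu> / (16 * (1 + \<mu>))\<close> times \<open>S\<^sup>2 - 2 * (w * V)\<close>, which is
  nonnegative by \<open>w \<le> S\<close> and \<open>V \<le> S / 2\<close>.\<close>

lemma fourth_power_estimate:
  fixes P Q S C V \<alpha> r \<mu> :: real
  assumes PQ: "P \<ge> 0" "Q \<ge> 0" "P + Q \<le> S" and C: "0 \<le> C" "C \<le> \<bar>P - Q\<bar>"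
    and r: "0 \<le> r" "r \<le> sqrt (P * Q)" "r \<le> V" and V: "V \<le> S / 2"
    and \<alpha>: "2 * \<alpha>\<^sup>2 \<le> sqrt (P * Q) + r" and \<mu>: "\<mu> \<ge> 0"
  shows "\<alpha> ^ 4 \<le> (1 + 2 * \<mu>) / (16 * (1 + \<mu>)) * S\<^sup>2 - 1 / 16 * C\<^sup>2
    + (3 + 2 * \<mu>) / (8 * (1 + \<mu>)) * V * sqrt (S\<^sup>2 - C\<^sup>2)"
proof -
  define q where "q = sqrt (P * Q)"
  define w where "w = sqrt (S\<^sup>2 - C\<^sup>2)"
  have q0: "q \<ge> 0" and q2: "q\<^sup>2 = P * Q" using PQ by (simp_all add: q_def)
  have S0: "S \<ge> 0" and V0: "V \<ge> 0" using PQ r by linarith+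
  have "4 * (P * Q) = (P + Q)\<^sup>2 - (P - Q)\<^sup>2" by (simp add: power2_eq_square algebra_simps)
  moreover have "(P + Q)\<^sup>2 \<le> S\<^sup>2" using PQ by (intro power_mono) auto
  moreover have "C\<^sup>2 \<le> (P - Q)\<^sup>2" using power_mono[OF C(2,1), of 2] by simp
  ultimately have qw: "4 * q\<^sup>2 \<le> S\<^sup>2 - C\<^sup>2" using q2 by simp
  then have SC: "S\<^sup>2 - C\<^sup>2 \<ge> 0" using zero_le_power2[of q] by linarith
  then have w2: "w\<^sup>2 = S\<^sup>2 - C\<^sup>2" unfolding w_def by simp
  have w0: "w \<ge> 0" unfolding w_def using SC by (rule real_sqrt_ge_zero)
  have "(2 * q)\<^sup>2 \<le> w\<^sup>2" using qw w2 by (simp add: power_mult_distrib)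
  then have q_w: "2 * q \<le> w" using w0 by (rule power2_le_imp_le)
  have "w\<^sup>2 \<le> S\<^sup>2" using w2 zero_le_power2[of C] by linarith
  then have w_S: "w \<le> S" using S0 by (rule power2_le_imp_le)
  have "(2 * \<alpha>\<^sup>2)\<^sup>2 \<le> (q + r)\<^sup>2" using \<alpha> by (intro power_mono) (auto simp: q_def)
  then have "4 * \<alpha> ^ 4 \<le> q\<^sup>2 + 2 * (q * r) + r * r"
    by (simp add: power2_eq_square power4_eq_xxxx algebra_simps)
  \<comment> \<open>One factor \<open>r\<close> is bounded by \<open>q\<close> and the other by
    \<open>V\<close>. Together with the two copies of \<open>q * r\<close> this makes up the
    constant 3.\<close>
  also have "r * r \<le> q * V" using r q0 by (intro mult_mono) (auto simp: q_def)
  also have "q * r \<le> q * V" using r q0 by (intro mult_left_mono)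
  finally have "4 * \<alpha> ^ 4 \<le> q\<^sup>2 + 3 * (q * V)" by (simp add: mult.commute)
  moreover have "2 * (q * V) \<le> w * V" using mult_right_mono[OF q_w V0] by (simp add: mult.assoc)
  ultimately have base: "\<alpha> ^ 4 \<le> w\<^sup>2 / 16 + 3 / 8 * (w * V)" using qw w2 by linarith
  have "w * V \<le> S * (S / 2)" using w_S V w0 V0 S0 by (intro mult_mono)
  then have "0 \<le> \<mu> / (16 * (1 + \<mu>)) * (S\<^sup>2 - 2 * (w * V))"
    using \<mu> by (intro mult_nonneg_nonneg) (auto simp: power2_eq_square)
  with base have "\<alpha> ^ 4 \<le> w\<^sup>2 / 16 + 3 / 8 * (w * V) + \<mu> / (16 * (1 + \<mu>)) * (S\<^sup>2 - 2 * (w * V))"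
    by simp
  also have "\<dots> = (1 + 2 * \<mu>) / (16 * (1 + \<mu>)) * S\<^sup>2 - 1 / 16 * C\<^sup>2 + (3 + 2 * \<mu>) / (8 * (1 + \<mu>)) * V * w"
    unfolding w2 using \<mu> by (simp add: divide_simps) (simp add: algebra_simps)
  finally show ?thesis unfolding w_def .
qed

theorem theorem3p1:
  fixes a :: "'a::unital_cstar_algebra"
    and k :: nat
    and x xs :: "nat \<Rightarrow> 'a"
    and p :: "nat \<Rightarrow> real"
    and \<mu> :: real
  assumes "positive_element a" and "a \<noteq> 0"
    and "k \<ge> 1"
    and "\<And>j. j \<in> {1..k} \<Longrightarrow> x j \<in> a_adjointable a"
    and "\<And>j. j \<in> {1..k} \<Longrightarrow> is_a_adjoint a (x j) (xs j)"
    and "\<mu> \<ge> 0"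
    and "\<And>j. j \<in> {1..k} \<Longrightarrow> p j \<ge> 0"
    and "(\<Sum>j=1..k. p j) = 1"
  shows "(a_numerical_radius a (\<Sum>j=1..k. p j *\<^sub>R x j)) ^ 4
    \<le> (1 + 2 * \<mu>) / (16 * (1 + \<mu>))
          * (\<Sum>j=1..k. p j * a_seminorm a (xs j * x j + x j * xs j))\<^sup>2
      - 1 / 16 * (a_crawford_number a (\<Sum>j=1..k. p j *\<^sub>R (xs j * x j - x j * xs j)))\<^sup>2
      + (3 + 2 * \<mu>) / (8 * (1 + \<mu>))
          * a_numerical_radius a (\<Sum>j=1..k. p j *\<^sub>R (x j)\<^sup>2)
          * sqrt ((\<Sum>j=1..k. p j * a_seminorm a (xs j * x j + x j * xs j))\<^sup>2
                  - (a_crawford_number a (\<Sum>j=1..k. p j *\<^sub>R (xs j * x j - x j * xs j)))\<^sup>2)"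
proof -
  define S where "S = (\<Sum>j=1..k. p j * a_seminorm a (xs j * x j + x j * xs j))"
  define D where "D = (\<Sum>j=1..k. p j *\<^sub>R (xs j * x j - x j * xs j))"
  define X where "X = (\<Sum>j=1..k. p j *\<^sub>R x j)"
  define W where "W = (\<Sum>j=1..k. p j *\<^sub>R (x j)\<^sup>2)"
  define R where "R = (1 + 2 * \<mu>) / (16 * (1 + \<mu>)) * S\<^sup>2 - 1 / 16 * (a_crawford_number a D)\<^sup>2
    + (3 + 2 * \<mu>) / (8 * (1 + \<mu>)) * a_numerical_radius a W * sqrt (S\<^sup>2 - (a_crawford_number a D)\<^sup>2)"
  have a: "a \<in> pos_cone" using assms(1) by (rule positive_element_in_pos_cone)
  have ne: "a_states a \<noteq> {}" using assms(1,2) by (rule a_states_nonempty)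
  have range: "a_numerical_range a z = (\<lambda>\<phi>. \<phi> (a * z)) ` a_states a" for z
    by (auto simp: a_numerical_range_def)
  \<comment> \<open>Serves twice: it bounds the radius at \<open>W\<close> by \<open>S / 2\<close>,
    and it shows that the supremum defining that radius is over a bounded set.\<close>
  have W_bound: "cmod (\<phi> (a * W)) \<le> S / 2" if \<phi>: "\<phi> \<in> a_states a" for \<phi>
  proof -
    obtain P Q where PQ: "P \<ge> 0" "Q \<ge> 0" "P + Q \<le> S" "\<phi> (a * D) = of_real (P - Q)"
      "cmod (\<phi> (a * W)) \<le> sqrt (P * Q)"
      "2 * (cmod (\<phi> (a * X)))\<^sup>2 \<le> sqrt (P * Q) + cmod (\<phi> (a * W))"
      by (rule a_state_Buzano[where x = x and y = xs, OF \<phi> a _ _ assms(8), folded S_def W_def D_def X_def])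
         (blast intro: assms(5,7))+
    then show ?thesis using arith_geo_mean_sqrt[of P Q] by simp
  qed
  have V: "a_numerical_radius a W \<le> S / 2"
    unfolding a_numerical_radius_def range image_image using ne W_bound by (intro cSUP_least)
  have W_le: "cmod (\<phi> (a * W)) \<le> a_numerical_radius a W" if "\<phi> \<in> a_states a" for \<phi>
    unfolding a_numerical_radius_def range image_image
    using that W_bound by (intro cSUP_upper bdd_aboveI2)
  have C0: "a_crawford_number a D \<ge> 0"
    unfolding a_crawford_number_def range image_image using ne by (intro cINF_greatest) auto
  have C_le: "a_crawford_number a D \<le> cmod (\<phi> (a * D))" if "\<phi> \<in> a_states a" for \<phi>
    unfolding a_crawford_number_def range image_image
    using that by (intro cINF_lower bdd_belowI2[where m=0]) auto
  have main: "cmod (\<phi> (a * X)) ^ 4 \<le> R" if \<phi>: "\<phi> \<in> a_states a" for \<phi>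
  proof -
    obtain P Q where PQ: "P \<ge> 0" "Q \<ge> 0" "P + Q \<le> S" "\<phi> (a * D) = of_real (P - Q)"
      "cmod (\<phi> (a * W)) \<le> sqrt (P * Q)"
      "2 * (cmod (\<phi> (a * X)))\<^sup>2 \<le> sqrt (P * Q) + cmod (\<phi> (a * W))"
      by (rule a_state_Buzano[where x = x and y = xs, OF \<phi> a _ _ assms(8), folded S_def W_def D_def X_def])
         (blast intro: assms(5,7))+
    have "cmod (\<phi> (a * D)) = \<bar>P - Q\<bar>" unfolding PQ(4) by (rule norm_of_real)
    then show ?thesis
      unfolding R_def using PQ C0 C_le[OF \<phi>] W_le[OF \<phi>] V assms(6)
      by (intro fourth_power_estimate[where P=P and Q=Q and r="cmod (\<phi> (a * W))"]) auto
  qed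
  \<comment> \<open>The supremum is over moduli, not their fourth powers, so the pointwise bound
    passes through \<open>root 4\<close>. Raising it back needs \<open>R \<ge> 0\<close>, which a
    single a-state provides.\<close>
  obtain \<phi>0 where \<phi>0: "\<phi>0 \<in> a_states a" using ne by blast
  have "0 \<le> cmod (\<phi>0 (a * X)) ^ 4" by simp
  also have "\<dots> \<le> R" by (rule main[OF \<phi>0])
  finally have R0: "R \<ge> 0" .
  have root: "cmod (\<phi> (a * X)) \<le> root 4 R" if "\<phi> \<in> a_states a" for \<phi>
    using real_root_le_mono[OF _ main[OF that], of 4] by (simp add: real_root_power_cancel)
  have "a_numerical_radius a X \<le> root 4 R"
    unfolding a_numerical_radius_def range image_image using ne root by (intro cSUP_least)
  moreover have "0 \<le> a_numerical_radius a X"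
  proof (rule order.trans[OF norm_ge_zero])
    show "cmod (\<phi>0 (a * X)) \<le> a_numerical_radius a X"
      unfolding a_numerical_radius_def range image_image
      using \<phi>0 root by (intro cSUP_upper bdd_aboveI2)
  qed
  ultimately have "a_numerical_radius a X ^ 4 \<le> root 4 R ^ 4" by (intro power_mono)
  then have "a_numerical_radius a X ^ 4 \<le> R" using R0 by simp
  then show ?thesis unfolding R_def S_def D_def X_def W_def .
qed

end
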